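(* Let $d\in\{2,3\}$, $\overline{\varkappa}\in\mathbb{R}$, $m\ge 0$, and let $\Gamma^{m-1},\Gamma^m\subset\mathbb{R}^d$ be polyhedral surfaces as in the context, with given $\varkappa^m,\kappa^m\in\mathbb{V}^h(\Gamma^{m-1})$. Let $(\mathscr{V}^{m+1},\varkappa^{m+1})\in[\mathbb{V}^h(\Gamma^m)]^2$, together with $(\lambda^{m+1},\mu^{m+1})\in\mathbb{R}^2$, be a solution of the linear system (S1)--(S4) stated in the context. Then for any time step size $\Delta t>0$, $$\mathcal{E}(\Gamma^m,\varkappa^{m+1})+\Delta t\,\|\mathscr{V}^{m+1}\|_{\Gamma^m}^2\le \mathcal{E}(\Gamma^{m-1},\varkappa^m),$$ where $\mathcal{E}(\Gamma^{m-1},\varkappa^m):=\frac12\int_{\Gamma^{m-1}}(\varkappa^m-\overline{\varkappa})^2\,d\mathcal{H}^{d-1}$ (and likewise $\mathcal{E}(\Gamma^m,\varkappa^{m+1}):=\frac12\int_{\Gamma^{m}}(\varkappa^{m+1}-\overline{\varkappa})^2\,d\mathcal{H}^{d-1}$), and $\|\cdot\|_{\Gamma^m}$ is the norm induced by the $L^2(\Gamma^m)$ inner product.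
   Context: Polyhedral surfaces. For each $m$, $\Gamma^m=\bigcup_{j=1}^J\overline{\sigma_j^m}\subset\mathbb{R}^d$ is a closed (boundaryless), oriented polyhedral hypersurface, where $\mathscr{T}^m=\{\sigma_j^m\}_{j=1}^J$ are mutually disjoint open nondegenerate $(d-1)$-simplices (segments if $d=2$, triangles if $d=3$) with vertex set $\{\vec q_k^m\}_{k=1}^K$; the connectivity of the mesh is the same for all $m$. By convention $\Gamma^{-1}=\Gamma^0$. Let $\vec q_{j_1}^m,\dots,\vec q_{j_d}^m$ be the vertices of $\sigma_j^m$, ordered consistently with the outward orientation, and let $\vec N(\sigma_j^m)=(\vec q_{j_2}^m-\vec q_{j_1}^m)^\perp$ for $d=2$ ($\perp$ = clockwise rotation by $\pi/2$), $\vec N(\sigma_j^m)=(\vec q_{j_2}^m-\vec q_{j_1}^m)\times(\vec q_{j_3}^m-\vec q_{j_1}^m)$ for $d=3$; the unit normal is $\vec\nu^m|_{\sigma_j^m}=\vec N(\sigma_j^m)/|\vec N(\sigma_j^m)|$, and $|\sigma_j^m|=\frac1{(d-1)!}|\vec N(\sigma_j^m)|$. Spaces and inner products. $\mathbb{V}^h(\Gamma^m)=\{\varphi\in C(\Gamma^m):\varphi|_\sigma\text{ affine for all }\sigma\in\mathscr{T}^m\}$; $(\cdot,\cdot)_{\Gamma^m}$ is the $L^2(\Gamma^m)$ inner product (for scalars, vectors, matrices); $\nabla_s$ is the elementwise tangential gradient. The mass-lumped product is $(u,v)^h_{\Gamma^m}=\frac1d\sum_{j=1}^J|\sigma_j^m|\sum_{k=1}^d\lim_{\sigma_j^m\ni\vec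 p\to\vec q_{j_k}^m}(u\cdot v)(\vec p)$ for piecewise continuous $u,v$. Vertex normals. $\vec\omega^m\in[\mathbb{V}^h(\Gamma^m)]^d$ is defined by $(\vec\omega^m,\vec\eta^h)^h_{\Gamma^m}=(\vec\nu^m,\vec\eta^h)_{\Gamma^m}$ for all $\vec\eta^h\in[\mathbb{V}^h(\Gamma^m)]^d$; it is assumed nonzero at every vertex. $\vec v^m\in[\mathbb{V}^h(\Gamma^m)]^d$ has vertex values $\vec\omega^m(\vec q)/|\vec\omega^m(\vec q)|$, and $\mathcal{W}^m=|\nabla_s\vec v^m|^2$ (Frobenius norm squared). Mesh velocity and pullback. $\vec{\mathscr{V}}^m\in[\mathbb{V}^h(\Gamma^m)]^d$ is given by $\vec{\mathscr{V}}^m(\vec q_k^m)=(\vec q_k^m-\vec q_k^{m-1})/\Delta t$ (so $\vec{\mathscr V}^0=\vec 0$), and $\vec\Phi^m=\vec{\mathrm{id}}|_{\Gamma^m}-\Delta t\,\vec{\mathscr{V}}^m$, so $\vec\Phi^m(\Gamma^m)=\Gamma^{m-1}$, mapping $\sigma_j^m$ affinely onto $\sigma_j^{m-1}$. $\mathcal{J}^m=\sqrt{\det\mathcal{L}^m}$ is the surface Jacobian of $\vec\Phi^m$, where $\mathcal{L}^m=(\nabla_s\vec\Phi^m)^T\nabla_s\vec\Phi^m$ is viewed as a linear operator on the tangent space of $\Gamma^m$. $\varkappa^m,\kappa^m\in\mathbb{V}^h(\Gamma^{m-1})$ are given ("evolution" and "geometric" curvatures), $\varkappa^m_{\Gamma^m}=\varkappa^m\circ\vec\Phi^m\in\mathbb{V}^h(\Gamma^m)$,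 and $\kappa^m$ is also regarded as an element of $\mathbb{V}^h(\Gamma^m)$ through its vertex values (i.e. composed with $\vec\Phi^m$). Antisymmetric form. $\mathscr{A}_{\Gamma^m}(\vec\eta,u,v)=\frac12(\vec\eta\cdot\nabla_su,v)_{\Gamma^m}-\frac12(\vec\eta\cdot\nabla_sv,u)_{\Gamma^m}$. Linear system: find $(\mathscr{V}^{m+1},\varkappa^{m+1})\in[\mathbb{V}^h(\Gamma^m)]^2$, $(\lambda^{m+1},\mu^{m+1})\in\mathbb{R}^2$ such that for all $\varphi^h,\chi^h\in\mathbb{V}^h(\Gamma^m)$: (S1) $(\mathscr{V}^{m+1},\varphi^h)_{\Gamma^m}-(\nabla_s\varkappa^{m+1},\nabla_s\varphi^h)_{\Gamma^m}+(\mathcal{W}^m[\varkappa^{m+1}-\overline{\varkappa}],\varphi^h)_{\Gamma^m}-\frac12([\varkappa^m_{\Gamma^m}-\overline{\varkappa}]\varkappa^m_{\Gamma^m}[\varkappa^{m+1}-\overline{\varkappa}],\varphi^h)_{\Gamma^m}-\lambda^{m+1}(1,\varphi^h)_{\Gamma^m}-\mu^{m+1}(\kappa^m,\varphi^h)_{\Gamma^m}=0$; (S2) $\Big(\frac{\varkappa^{m+1}-\overline{\varkappa}-(\varkappa^m_{\Gamma^m}-\overline{\varkappa})\sqrt{\mathcal{J}^m}}{\Delta t},\chi^h\Big)_{\Gamma^m}-\mathscr{A}_{\Gamma^m}(\vec{\mathscr{V}}^m,\varkappa^{m+1}-\overline{\varkappa},\chi^h)+(\nabla_s\mathscr{V}^{m+1},\nabla_s\chi^h)_{\Gamma^m}-(\mathcal{W}^m\mathscr{V}^{m+1},\chi^h)_{\Gamma^m}+\frac12(\mathscr{V}^{m+1},[\varkappa^m_{\Gamma^m}-\overline{\varkappa}]\varkappa^m_{\Gamma^m}\chi^h)_{\Gamma^m}=0$;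 (S3) $(\mathscr{V}^{m+1},1)_{\Gamma^m}=0$; (S4) $(\mathscr{V}^{m+1}\kappa^m,1)_{\Gamma^m}=0$. *)

theory Defs
  imports "HOL-Analysis.Analysis"
begin

section \<open>Hausdorff measure\<close>

text \<open>
  The factor \<open>unit_ball_vol k / 2 ^ k\<close> makes the \<open>k\<close>-dimensional measure agree with Lebesgue
  measure on \<open>k\<close>-planes. The bound \<open>bounded (C i)\<close> is needed because \<open>diameter\<close> is unspecified
  on unbounded sets. Only \<open>k \<ge> 1\<close> is used, so empty covering sets contribute \<open>0\<close>.
\<close>

definition hausdorff_outer :: "nat \<Rightarrow> 'a::metric_space set \<Rightarrow> ennreal" where
  "hausdorff_outer k A =
    (SUP \<delta>\<in>{0::real<..}.
      INF C\<in>{C :: nat \<Rightarrow> 'a set. A \<subseteq> (\<Union>i. C i) \<and> (\<forall>i. bounded (C i) \<and> diameter (C i) \<le> \<delta>)}.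
        \<Sum>i. ennreal (unit_ball_vol (real k) * (diameter (C i) / 2) ^ k))"

text \<open>
  The Hausdorff outer measure is a metric outer measure, hence countably additive on Borel sets,
  so \<open>measure_of\<close> does not collapse to the null measure here.
\<close>

definition hausdorff :: "nat \<Rightarrow> 'a::metric_space measure" where
  "hausdorff k = measure_of UNIV (sets borel) (hausdorff_outer k)"


section \<open>Polyhedral surfaces\<close>

text \<open>
  A mesh consists of its connectivity \<open>T\<close>, a finite set of elements, each given by the ordered list
  of the indices of its vertices, and of the vertex positions \<open>q\<close>. The parameter \<open>N\<close> maps
  the ordered list of the vertices of a simplex to its (non-normalised) normal; it is
  \<open>normal2\<close> in the plane and \<open>normal3\<close> in space.
\<close>

definition normal2 :: "(real^2) list \<Rightarrow> real^2" where
  "normal2 ps = (let e = ps ! 1 - ps ! 0 in vector [e $ 2, - (e $ 1)])"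

definition normal3 :: "(real^3) list \<Rightarrow> real^3" where
  "normal3 ps = cross3 (ps ! 1 - ps ! 0) (ps ! 2 - ps ! 0)"

definition vertices :: "nat list set \<Rightarrow> nat set" where
  "vertices T = (\<Union>s\<in>T. set s)"

definition open_simplex :: "(nat \<Rightarrow> real^'n) \<Rightarrow> nat list \<Rightarrow> (real^'n) set" where
  "open_simplex q s = rel_interior (convex hull (q ` set s))"

definition surface :: "nat list set \<Rightarrow> (nat \<Rightarrow> real^'n) \<Rightarrow> (real^'n) set" where
  "surface T q = (\<Union>s\<in>T. closure (open_simplex q s))"

definition tangent_space :: "(nat \<Rightarrow> real^'n) \<Rightarrow> nat list \<Rightarrow> (real^'n) set" where
  "tangent_space q s = span ((\<lambda>k. q k - q (hd s)) ` set s)"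

definition simplex_measure ::
  "((real^'n) list \<Rightarrow> real^'n) \<Rightarrow> (nat \<Rightarrow> real^'n) \<Rightarrow> nat list \<Rightarrow> real" where
  "simplex_measure N q s = norm (N (map q s)) / fact (CARD('n) - 1)"

definition simplex_unit_normal ::
  "((real^'n) list \<Rightarrow> real^'n) \<Rightarrow> (nat \<Rightarrow> real^'n) \<Rightarrow> nat list \<Rightarrow> real^'n" where
  "simplex_unit_normal N q s = N (map q s) /\<^sub>R norm (N (map q s))"

text \<open>
  The last two conditions say that the surface is a hypersurface without boundary (locally
  homeomorphic to a hyperplane), and that it bounds a region \<open>\<Omega>\<close> such that
  the vertex ordering of every element makes its normal point out of \<open>\<Omega>\<close>.
\<close>

definition polyhedral_surface ::
  "((real^'n) list \<Rightarrow> real^'n) \<Rightarrow> nat list set \<Rightarrow> (nat \<Rightarrow> real^'n) \<Rightarrow> bool" where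
  "polyhedral_surface N T q \<longleftrightarrow>
     finite T \<and>
     (\<forall>s\<in>T. length s = CARD('n) \<and> distinct s) \<and>
     inj_on q (vertices T) \<and>
     (\<forall>s\<in>T. \<not> affine_dependent (q ` set s)) \<and>
     (\<forall>s\<in>T. \<forall>t\<in>T. s \<noteq> t \<longrightarrow> open_simplex q s \<inter> open_simplex q t = {}) \<and>
     (\<forall>s\<in>T. \<forall>t\<in>T. closure (open_simplex q s) \<inter> closure (open_simplex q t)
                      = convex hull (q ` (set s \<inter> set t))) \<and>
     (\<forall>p\<in>surface T q. \<exists>U a. p \<in> U \<and> openin (top_of_set (surface T q)) U \<and>
                              a \<noteq> 0 \<and> U homeomorphic {x::real^'n. a \<bullet> x = 0}) \<and>
     (\<exists>\<Omega>. open \<Omega> \<and> bounded \<Omega> \<and> frontier \<Omega> = surface T q \<and>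
        (\<forall>s\<in>T. \<forall>p\<in>open_simplex q s. \<exists>\<epsilon>>0. \<forall>t\<in>{0<..<\<epsilon>}.
           p - t *\<^sub>R simplex_unit_normal N q s \<in> \<Omega> \<and>
           p + t *\<^sub>R simplex_unit_normal N q s \<notin> closure \<Omega>))"


section \<open>Function spaces, inner products and surface gradients\<close>

text \<open>
  Functions on a surface are total functions on the ambient space of which only the values on the
  surface matter. \<open>Vh\<close> is used with real values for the scalar space and with vector values for
  its \<open>d\<close>-fold power.
\<close>

definition Vh ::
  "nat list set \<Rightarrow> (nat \<Rightarrow> real^'n) \<Rightarrow> (real^'n \<Rightarrow> 'b::real_normed_vector) set" where
  "Vh T q = {\<phi>. continuous_on (surface T q) \<phi> \<and>
     (\<forall>s\<in>T. \<exists>A b. linear A \<and> (\<forall>p\<in>open_simplex q s. \<phi> p = A p + b))}"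

definition surface_integral ::
  "nat list set \<Rightarrow> (nat \<Rightarrow> real^'n) \<Rightarrow> (real^'n \<Rightarrow> real) \<Rightarrow> real" where
  "surface_integral T q f = set_lebesgue_integral (hausdorff (CARD('n) - 1)) (surface T q) f"

definition L2_inner ::
  "nat list set \<Rightarrow> (nat \<Rightarrow> real^'n) \<Rightarrow> (real^'n \<Rightarrow> 'b::real_inner) \<Rightarrow> (real^'n \<Rightarrow> 'b) \<Rightarrow> real" where
  "L2_inner T q u v = surface_integral T q (\<lambda>p. u p \<bullet> v p)"

definition L2_norm ::
  "nat list set \<Rightarrow> (nat \<Rightarrow> real^'n) \<Rightarrow> (real^'n \<Rightarrow> 'b::real_inner) \<Rightarrow> real" where
  "L2_norm T q u = sqrt (L2_inner T q u u)"

definition lumped_inner ::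
  "((real^'n) list \<Rightarrow> real^'n) \<Rightarrow> nat list set \<Rightarrow> (nat \<Rightarrow> real^'n) \<Rightarrow>
   (real^'n \<Rightarrow> 'b::real_inner) \<Rightarrow> (real^'n \<Rightarrow> 'b) \<Rightarrow> real" where
  "lumped_inner N T q u v =
     (\<Sum>s\<in>T. simplex_measure N q s *
        (\<Sum>k<CARD('n). Lim (at (q (s ! k)) within open_simplex q s) (\<lambda>p. u p \<bullet> v p)))
     / real CARD('n)"

text \<open>
  Elementwise defined fields are extended by \<open>0\<close> to the boundaries of the elements, which are
  null sets for the surface measure.
\<close>

definition elementwise ::
  "nat list set \<Rightarrow> (nat \<Rightarrow> real^'n) \<Rightarrow> (nat list \<Rightarrow> real^'n \<Rightarrow> 'b::zero) \<Rightarrow> real^'n \<Rightarrow> 'b" where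
  "elementwise T q F p =
     (if \<exists>s\<in>T. p \<in> open_simplex q s then F (THE s. s \<in> T \<and> p \<in> open_simplex q s) p else 0)"

definition unit_normal ::
  "((real^'n) list \<Rightarrow> real^'n) \<Rightarrow> nat list set \<Rightarrow> (nat \<Rightarrow> real^'n) \<Rightarrow> real^'n \<Rightarrow> real^'n" where
  "unit_normal N T q = elementwise T q (\<lambda>s p. simplex_unit_normal N q s)"

definition surf_grad ::
  "nat list set \<Rightarrow> (nat \<Rightarrow> real^'n) \<Rightarrow> (real^'n \<Rightarrow> real) \<Rightarrow> real^'n \<Rightarrow> real^'n" where
  "surf_grad T q u = elementwise T q (\<lambda>s p.
     THE g. g \<in> tangent_space q s \<and>
            (u has_derivative (\<lambda>h. g \<bullet> h)) (at p within open_simplex q s))"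

text \<open>
  For a vector field, row \<open>i\<close> of the surface gradient is the tangential gradient of the \<open>i\<close>-th
  component. The norm on \<open>real^'n^'n\<close> is the Frobenius norm.
\<close>

definition surf_grad_vec ::
  "nat list set \<Rightarrow> (nat \<Rightarrow> real^'n) \<Rightarrow> (real^'n \<Rightarrow> real^'n) \<Rightarrow> real^'n \<Rightarrow> real^'n^'n" where
  "surf_grad_vec T q f p = (\<chi> i. surf_grad T q (\<lambda>x. f x $ i) p)"

definition antisym_form ::
  "nat list set \<Rightarrow> (nat \<Rightarrow> real^'n) \<Rightarrow> (real^'n \<Rightarrow> real^'n) \<Rightarrow>
   (real^'n \<Rightarrow> real) \<Rightarrow> (real^'n \<Rightarrow> real) \<Rightarrow> real" where
  "antisym_form T q \<eta> u v =
     1/2 * L2_inner T q (\<lambda>p. \<eta> p \<bullet> surf_grad T q u p) v -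
     1/2 * L2_inner T q (\<lambda>p. \<eta> p \<bullet> surf_grad T q v p) u"

definition energy ::
  "nat list set \<Rightarrow> (nat \<Rightarrow> real^'n) \<Rightarrow> real \<Rightarrow> (real^'n \<Rightarrow> real) \<Rightarrow> real" where
  "energy T q \<kappa>bar \<kappa> = 1/2 * surface_integral T q (\<lambda>p. (\<kappa> p - \<kappa>bar)\<^sup>2)"


section \<open>Vertex normals\<close>

definition is_averaged_normal ::
  "((real^'n) list \<Rightarrow> real^'n) \<Rightarrow> nat list set \<Rightarrow> (nat \<Rightarrow> real^'n) \<Rightarrow> (real^'n \<Rightarrow> real^'n) \<Rightarrow> bool" where
  "is_averaged_normal N T q \<omega> \<longleftrightarrow> \<omega> \<in> Vh T q \<and>
     (\<forall>\<eta>\<in>Vh T q. lumped_inner N T q \<omega> \<eta> = L2_inner T q (unit_normal N T q) \<eta>)"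

definition is_vertex_normal ::
  "nat list set \<Rightarrow> (nat \<Rightarrow> real^'n) \<Rightarrow> (real^'n \<Rightarrow> real^'n) \<Rightarrow> (real^'n \<Rightarrow> real^'n) \<Rightarrow> bool" where
  "is_vertex_normal T q \<omega> v \<longleftrightarrow> v \<in> Vh T q \<and>
     (\<forall>k\<in>vertices T. v (q k) = \<omega> (q k) /\<^sub>R norm (\<omega> (q k)))"

definition Wsq ::
  "nat list set \<Rightarrow> (nat \<Rightarrow> real^'n) \<Rightarrow> (real^'n \<Rightarrow> real^'n) \<Rightarrow> real^'n \<Rightarrow> real" where
  "Wsq T q v p = (norm (surf_grad_vec T q v p))\<^sup>2"


section \<open>Mesh velocity and pullback\<close>

definition is_mesh_velocity ::
  "nat list set \<Rightarrow> (nat \<Rightarrow> real^'n) \<Rightarrow> (nat \<Rightarrow> real^'n) \<Rightarrow> real \<Rightarrow> (real^'n \<Rightarrow> real^'n) \<Rightarrow> bool" where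
  "is_mesh_velocity T q_old q \<tau> vel \<longleftrightarrow> vel \<in> Vh T q \<and>
     (\<forall>k\<in>vertices T. vel (q k) = (q k - q_old k) /\<^sub>R \<tau>)"

definition pullback_map :: "real \<Rightarrow> (real^'n \<Rightarrow> real^'n) \<Rightarrow> real^'n \<Rightarrow> real^'n" where
  "pullback_map \<tau> vel p = p - \<tau> *\<^sub>R vel p"

text \<open>
  The determinant of a linear operator on a subspace, by the Leibniz formula for its matrix with
  respect to an orthonormal basis (the value does not depend on the basis).
\<close>

definition det_on :: "'a::euclidean_space set \<Rightarrow> ('a \<Rightarrow> 'a) \<Rightarrow> real" where
  "det_on S L =
     (let B = (SOME B. pairwise orthogonal B \<and> (\<forall>b\<in>B. norm b = 1) \<and> span B = S)
      in \<Sum>\<pi>\<in>{\<pi>. \<pi> permutes B}. of_int (sign \<pi>) * (\<Prod>b\<in>B. b \<bullet> L (\<pi> b)))"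

definition surf_jacobian ::
  "nat list set \<Rightarrow> (nat \<Rightarrow> real^'n) \<Rightarrow> (real^'n \<Rightarrow> real^'n) \<Rightarrow> real^'n \<Rightarrow> real" where
  "surf_jacobian T q \<Phi> = elementwise T q (\<lambda>s p.
     sqrt (det_on (tangent_space q s)
             (\<lambda>h. (transpose (surf_grad_vec T q \<Phi> p) ** surf_grad_vec T q \<Phi> p) *v h)))"


section \<open>The linear system\<close>

text \<open>
  The arguments \<open>\<kappa>e\<close> and \<open>\<kappa>g\<close> are the evolution and geometric curvatures given on the
  previous surface; both enter through their pullbacks to the current surface.
  For a sequence of meshes \<open>q m\<close>, the previous positions are \<open>q (m - 1)\<close>; truncated
  subtraction gives the convention that the surface with index \<open>-1\<close> is the initial one.
  The names \<open>ip\<close> and \<open>ipv\<close> are the same product, for scalar and for vector fields.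
\<close>

definition linear_system ::
  "nat list set \<Rightarrow> (nat \<Rightarrow> real^'n) \<Rightarrow> real \<Rightarrow> real \<Rightarrow> (real^'n \<Rightarrow> real) \<Rightarrow> (real^'n \<Rightarrow> real) \<Rightarrow>
   (real^'n \<Rightarrow> real^'n) \<Rightarrow> (real^'n \<Rightarrow> real^'n) \<Rightarrow>
   (real^'n \<Rightarrow> real) \<Rightarrow> (real^'n \<Rightarrow> real) \<Rightarrow> real \<Rightarrow> real \<Rightarrow> bool" where
  "linear_system T q \<tau> \<kappa>bar \<kappa>e \<kappa>g v vel V \<kappa>new lam mu \<longleftrightarrow>
    (let ip = L2_inner T q;
         ipv = L2_inner T q;
         grad = surf_grad T q;
         \<Phi> = pullback_map \<tau> vel;
         W = Wsq T q v;
         J = surf_jacobian T q \<Phi>;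
         \<kappa>\<Gamma> = \<kappa>e \<circ> \<Phi>;
         \<kappa>g\<Gamma> = \<kappa>g \<circ> \<Phi>
     in
      (\<forall>\<phi>\<in>Vh T q.
         ip V \<phi> - ipv (grad \<kappa>new) (grad \<phi>)
         + ip (\<lambda>p. W p * (\<kappa>new p - \<kappa>bar)) \<phi>
         - 1/2 * ip (\<lambda>p. (\<kappa>\<Gamma> p - \<kappa>bar) * \<kappa>\<Gamma> p * (\<kappa>new p - \<kappa>bar)) \<phi>
         - lam * ip (\<lambda>p. 1) \<phi> - mu * ip \<kappa>g\<Gamma> \<phi> = 0) \<and>
      (\<forall>\<psi>\<in>Vh T q.
         ip (\<lambda>p. (\<kappa>new p - \<kappa>bar - (\<kappa>\<Gamma> p - \<kappa>bar) * sqrt (J p)) / \<tau>) \<psi>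
         - antisym_form T q vel (\<lambda>p. \<kappa>new p - \<kappa>bar) \<psi>
         + ipv (grad V) (grad \<psi>)
         - ip (\<lambda>p. W p * V p) \<psi>
         + 1/2 * ip V (\<lambda>p. (\<kappa>\<Gamma> p - \<kappa>bar) * \<kappa>\<Gamma> p * \<psi> p) = 0) \<and>
      ip V (\<lambda>p. 1) = 0 \<and>
      ip (\<lambda>p. V p * \<kappa>g\<Gamma> p) (\<lambda>p. 1) = 0)"

end

theory Submission
  imports Defs
begin

text \<open>
  Write \<open>a = \<kappa>new - \<kappa>bar\<close> and \<open>b = (\<kappa>e \<circ> \<Phi> - \<kappa>bar) * sqrt J\<close>, where \<open>\<Phi>\<close> is the pullback to the previous
  surface and \<open>J\<close> its Jacobian. Testing the first equation of the system with \<open>V\<close> and the second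
  one with \<open>a\<close> makes all coupling terms cancel and leaves \<open>\<integral> (a - b) * a = - \<tau> * \<parallel>V\<parallel>\<^sup>2\<close>
  (lemma \<open>linear_system_energy_identity\<close>). Since \<open>(a - b) * a \<ge> a\<^sup>2 / 2 - b\<^sup>2 / 2\<close>, the new energy plus
  \<open>\<tau> * \<parallel>V\<parallel>\<^sup>2\<close> is at most \<open>\<integral> b\<^sup>2 / 2\<close>. The square root of \<open>J\<close> in the discrete time derivative is there
  precisely to make \<open>\<integral> b\<^sup>2 / 2 = \<integral> J * (\<kappa>e \<circ> \<Phi> - \<kappa>bar)\<^sup>2 / 2\<close> the energy on the previous
  surface, by the change of variables \<open>\<Phi>\<close> (lemma \<open>surface_change_of_variables\<close>). Lemma
  \<open>energy_stability\<close> combines the two facts, for any dimension.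

  The analytic substance is this change of variables for the Hausdorff measure, which reduces to
  one simplex, on which \<open>\<Phi>\<close> is affine. Read in isometric coordinates of a plane, the Hausdorff measure is
  translation invariant and finite on bounded sets, hence equal to \<open>c\<close> times Lebesgue measure
  (\<open>translation_invariant_eq_lborel\<close>), with one constant \<open>c\<close> for all planes of the same dimension
  (\<open>hausdorff_isometric_image\<close>). A linear parametrisation \<open>L\<close> of a plane therefore scales by \<open>c\<close> times
  the root of its Gram determinant (\<open>hausdorff_linear_image\<close>). Comparing the parametrisations of the
  current and of the previous simplex cancels \<open>c\<close>, and the remaining ratio of Gram determinants
  is the surface Jacobian (\<open>surf_jacobian_affine\<close>).
\<close>

section \<open>Hausdorff measure under contractions\<close>

text \<open>
  A covering of \<open>A\<close> by sets \<open>C i\<close> turns into the covering of the image by the sets \<open>f ` (C i \<inter> A)\<close>,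
  and their diameters do not grow. Intersecting with \<open>A\<close> is essential, since \<open>f\<close> is a contraction
  on \<open>A\<close> only.
\<close>

lemma hausdorff_outer_contraction:
  fixes f :: "'a::metric_space \<Rightarrow> 'b::metric_space"
  assumes f: "\<And>x y. x \<in> A \<Longrightarrow> y \<in> A \<Longrightarrow> dist (f x) (f y) \<le> dist x y"
  shows "hausdorff_outer k (f ` A) \<le> hausdorff_outer k A"
  unfolding hausdorff_outer_def
proof (rule SUP_mono, rule bexI, rule INF_mono)
  fix \<delta> :: real and C :: "nat \<Rightarrow> 'a set"
  assume C: "C \<in> {C. A \<subseteq> (\<Union>i. C i) \<and> (\<forall>i. bounded (C i) \<and> diameter (C i) \<le> \<delta>)}"
  have bd: "bounded (f ` (C i \<inter> A))" for i
  proof -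
    have "bounded (C i)" using C by auto
    then obtain e where "\<forall>x\<in>C i. \<forall>y\<in>C i. dist x y \<le> e" by (auto simp: bounded_two_points)
    then have "\<forall>x\<in>f ` (C i \<inter> A). \<forall>y\<in>f ` (C i \<inter> A). dist x y \<le> e"
      by (auto intro!: order_trans[OF f])
    then show ?thesis by (auto simp: bounded_two_points)
  qed
  have dia: "diameter (f ` (C i \<inter> A)) \<le> diameter (C i)" for i
  proof -
    have b: "bounded (C i)" using C by auto
    show ?thesis
    proof (cases "C i \<inter> A = {}")
      case True
      then show ?thesis using diameter_ge_0[OF b] by simp
    next
      case False
      then show ?thesis
        unfolding diameter_def[of "f ` _"]
        by (auto intro!: cSUP_least order_trans[OF f diameter_bounded_bound[OF b]])
    qed
  qed
  show "\<exists>D\<in>{D. f ` A \<subseteq> (\<Union>i. D i) \<and> (\<forall>i. bounded (D i) \<and> diameter (D i) \<le> \<delta>)}.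
      (\<Sum>i. ennreal (unit_ball_vol (real k) * (diameter (D i) / 2) ^ k))
      \<le> (\<Sum>i. ennreal (unit_ball_vol (real k) * (diameter (C i) / 2) ^ k))"
  proof (intro bexI[of _ "\<lambda>i. f ` (C i \<inter> A)"] suminf_le ennreal_leI mult_left_mono power_mono allI)
    show "diameter (f ` (C i \<inter> A)) / 2 \<le> diameter (C i) / 2" for i using dia[of i] by simp
    show "0 \<le> diameter (f ` (C i \<inter> A)) / 2" for i using diameter_ge_0[OF bd[of i]] by simp
    have "diameter (f ` (C i \<inter> A)) \<le> \<delta>" for i
    proof -
      have "diameter (C i) \<le> \<delta>" using C by blast
      with dia[of i] show ?thesis by linarith
    qed
    then show "(\<lambda>i. f ` (C i \<inter> A)) \<in> {D. f ` A \<subseteq> (\<Union>i. D i) \<and> (\<forall>i. bounded (D i) \<and> diameter (D i) \<le> \<delta>)}"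
      using C bd by blast
  qed simp_all
qed auto

lemma sets_hausdorff [simp, measurable_cong]: "sets (hausdorff k) = sets borel"
  unfolding hausdorff_def by (simp add: sets_measure_of_conv sets.sigma_sets_eq[of borel, simplified])

lemma space_hausdorff [simp]: "space (hausdorff k) = UNIV"
  unfolding hausdorff_def by (simp add: space_measure_of_conv)

text \<open>
  The operator \<open>measure_of\<close> returns the given set function if it is a measure on the generated
  \<sigma>-algebra, and the null measure otherwise. Monotonicity under contractions and finiteness on bounded
  sets pass from the outer measure to the measure in both cases, so the arguments below treat
  the two alternatives alike.
\<close>

lemma emeasure_hausdorff:
  fixes k :: nat
  defines "H \<equiv> hausdorff k :: 'a::metric_space measure"
  shows "(\<forall>A\<in>sets borel. emeasure H A = hausdorff_outer k A) \<or> (\<forall>A. emeasure H A = 0)"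
  using sets.sigma_sets_eq[of "borel :: 'a measure"]
  by (auto simp: H_def hausdorff_def emeasure_measure_of_conv)

lemma emeasure_hausdorff_contraction:
  fixes f :: "'a::metric_space \<Rightarrow> 'a"
  assumes "A \<in> sets borel" "f ` A \<in> sets borel"
    and "\<And>x y. x \<in> A \<Longrightarrow> y \<in> A \<Longrightarrow> dist (f x) (f y) \<le> dist x y"
  shows "emeasure (hausdorff k) (f ` A) \<le> emeasure (hausdorff k) A"
  using emeasure_hausdorff[of k, where 'a='a] hausdorff_outer_contraction[of A f k] assms by auto

text \<open>
  Two images of one set under maps that induce the same distances are contractions of each other.
  This is the form in which isometry invariance is used: two isometric copies of a subset
  of \<open>real^'k\<close>, lying in different planes of the ambient space, have the same measure.
\<close>

lemma emeasure_hausdorff_isometric: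
  fixes f g :: "'b \<Rightarrow> 'a::metric_space"
  assumes "f ` B \<in> sets borel" "g ` B \<in> sets borel"
    and d: "\<And>x y. x \<in> B \<Longrightarrow> y \<in> B \<Longrightarrow> dist (f x) (f y) = dist (g x) (g y)"
  shows "emeasure (hausdorff k) (f ` B) = emeasure (hausdorff k) (g ` B)"
proof -
  have *: "emeasure (hausdorff k) (f ` B) \<le> emeasure (hausdorff k) (g ` B)"
    if b: "f ` B \<in> sets borel" "g ` B \<in> sets borel"
    and d: "\<And>x y. x \<in> B \<Longrightarrow> y \<in> B \<Longrightarrow> dist (f x) (f y) = dist (g x) (g y)"
    for f g :: "'b \<Rightarrow> 'a"
  proof -
    \<comment> \<open>The map \<open>h\<close> is well defined on \<open>g ` B\<close>: points with equal \<open>g\<close>-values have distance 0,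
      hence equal \<open>f\<close>-values.\<close>
    define h where "h = f \<circ> inv_into B g"
    have i: "inv_into B g (g x) \<in> B" "g (inv_into B g (g x)) = g x" if "x \<in> B" for x
      using that by (auto intro: inv_into_into f_inv_into_f)
    have "h (g x) = f x" if "x \<in> B" for x
      using d[OF i(1)[OF that] that] i(2)[OF that] by (simp add: h_def)
    then have e: "f ` B = h ` g ` B" and h: "\<And>x. x \<in> B \<Longrightarrow> h (g x) = f x"
      by (auto simp: image_image)
    show ?thesis
      unfolding e
    proof (rule emeasure_hausdorff_contraction)
      fix x y assume "x \<in> g ` B" "y \<in> g ` B"
      then show "dist (h x) (h y) \<le> dist x y" using h d by auto
    qed (use b e in simp_all)
  qed
  show ?thesis using *[of f g] *[of g f] assms by (auto intro: antisym)
qed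

text \<open>
  Cut the cube with half side \<open>M\<close> into \<open>N ^ k\<close> cells of side \<open>2 * M / N\<close>. A cell has diameter at most
  \<open>2 * M * k / N\<close>, so the cells together contribute at most \<open>unit_ball_vol k * (k * M) ^ k\<close>,
  whatever \<open>N\<close> is, while their diameters become arbitrarily small.
\<close>

lemma hausdorff_outer_cube_finite:
  fixes M :: real
  assumes M: "M \<ge> 0"
  shows "hausdorff_outer CARD('k) {x :: real^'k. \<forall>i. \<bar>x $ i\<bar> \<le> M} < \<infinity>"
proof -
  define k where "k = CARD('k)"
  have k: "k \<ge> 1" by (simp add: k_def Suc_le_eq)
  define V where "V = unit_ball_vol (real k)"
  have V: "V \<ge> 0" by (simp add: V_def)
  define b where "b = ennreal (V * (real k * M) ^ k)"
  have "hausdorff_outer k {x :: real^'k. \<forall>i. \<bar>x $ i\<bar> \<le> M} \<le> b"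
    unfolding hausdorff_outer_def
  proof (rule SUP_least)
    fix \<delta> :: real assume "\<delta> \<in> {0<..}"
    then have \<delta>: "\<delta> > 0" by simp
    obtain N' :: nat where N': "2 * M * real k / \<delta> < real N'" using reals_Archimedean2 by blast
    define N where "N = Suc N'"
    have N: "real N > 0" "2 * M * real k / real N \<le> \<delta>"
      using N' \<delta> by (auto simp: N_def field_simps)
    define I where "I = (PiE UNIV (\<lambda>_. {..<N}) :: ('k \<Rightarrow> nat) set)"
    have finI: "finite I" by (auto simp: I_def intro!: finite_PiE)
    have cardI: "card I = N ^ k" by (simp add: I_def card_PiE k_def)
    obtain e where e: "bij_betw e {..<N^k} I"
      using ex_bij_betw_nat_finite[OF finI] cardI by (auto simp: atLeast0LessThan)
    define cell where "cell z = {x :: real^'k. \<forall>i. - M + 2 * M / N * real (z i) \<le> x $ i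
        \<and> x $ i \<le> - M + 2 * M / N * (real (z i) + 1)}" for z
    have cellb: "norm (x - y) \<le> 2 * M * real k / real N" if "x \<in> cell z" "y \<in> cell z" for x y z
    proof -
      have "norm (x - y) \<le> (\<Sum>i\<in>UNIV. \<bar>(x - y) $ i\<bar>)" by (rule norm_le_l1_cart)
      also have "\<dots> \<le> (\<Sum>i\<in>(UNIV::'k set). 2 * M / N)"
      proof (rule sum_mono)
        fix i
        have "- M + 2 * M / N * real (z i) \<le> x $ i" "x $ i \<le> - M + 2 * M / N * (real (z i) + 1)"
          "- M + 2 * M / N * real (z i) \<le> y $ i" "y $ i \<le> - M + 2 * M / N * (real (z i) + 1)"
          using that by (auto simp: cell_def)
        then show "\<bar>(x - y) $ i\<bar> \<le> 2 * M / N" by (auto simp: abs_le_iff ring_distribs)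
      qed
      finally show ?thesis by (simp add: k_def mult_ac)
    qed
    have cellB: "bounded (cell z)" for z
      unfolding bounded_two_points using cellb[of _ z] by (auto simp: dist_norm)
    have celld: "diameter (cell z) \<le> 2 * M * real k / real N" for z
      using M by (intro diameter_le cellb) auto
    define C where "C j = (if j < N^k then cell (e j) else {})" for j
    have cov: "{x :: real^'k. \<forall>i. \<bar>x $ i\<bar> \<le> M} \<subseteq> (\<Union>j. C j)"
    proof
      fix x :: "real^'k" assume "x \<in> {x. \<forall>i. \<bar>x $ i\<bar> \<le> M}"
      then have x: "- M \<le> x $ i" "x $ i \<le> M" for i by (auto simp: abs_le_iff minus_le_iff)
      have "\<exists>n. n < N \<and> - M + 2 * M / N * real n \<le> x $ i
              \<and> x $ i \<le> - M + 2 * M / N * (real n + 1)" for i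
      proof (cases "M = 0")
        case True
        then show ?thesis using x[of i] N by (intro exI[of _ 0]) auto
      next
        case False
        with M have M0: "M > 0" by simp
        define t where "t = (x $ i + M) * N / (2 * M)"
        have xt: "x $ i = - M + 2 * M / N * t" using M0 N by (simp add: t_def field_simps)
        have t0: "0 \<le> t" "t \<le> N"
        proof -
          have "0 \<le> (x $ i + M) / (2 * M)" "(x $ i + M) / (2 * M) \<le> 1"
            using x[of i] M0 by (auto simp: field_simps)
          from mult_right_mono[OF this(1), of N] mult_right_mono[OF this(2), of N]
          show "0 \<le> t" "t \<le> N" by (simp_all add: t_def)
        qed
        \<comment> \<open>The right end point of the range belongs to the last cell, whose index is \<open>N' = N - 1\<close>.\<close>
        define n where "n = (if t = N then N' else nat \<lfloor>t\<rfloor>)"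
        have n: "n < N" "real n \<le> t" "t \<le> real n + 1"
        proof -
          show "n < N"
          proof (cases "t = N")
            case False
            then have "t < N" using t0 by simp
            then show ?thesis using t0 False by (simp add: n_def nat_less_iff floor_less_iff)
          qed (simp add: n_def N_def)
          show "real n \<le> t" "t \<le> real n + 1"
            using t0 by (cases "t = N"; simp add: n_def N_def; linarith)+
        qed
        then show ?thesis using M0 N unfolding xt
          by (intro exI[of _ n]) (auto intro!: mult_left_mono divide_right_mono)
      qed
      then obtain z where "\<forall>i. z i < N \<and> - M + 2 * M / N * real (z i) \<le> x $ i
              \<and> x $ i \<le> - M + 2 * M / N * (real (z i) + 1)"
        using choice[of "\<lambda>i n. n < N \<and> - M + 2 * M / N * real n \<le> x $ i
              \<and> x $ i \<le> - M + 2 * M / N * (real n + 1)"] by blast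
      then have z: "\<And>i. z i < N" "x \<in> cell z" by (simp_all add: cell_def)
      then have "z \<in> I" by (auto simp: I_def)
      then obtain j where "j < N^k" "e j = z" using e by (auto simp: bij_betw_def image_iff)
      then show "x \<in> (\<Union>j. C j)" using z by (auto simp: C_def)
    qed
    have dC: "bounded (C j) \<and> diameter (C j) \<le> \<delta>" for j
      using celld[of "e j"] cellB[of "e j"] N \<delta> by (auto simp: C_def)
    have "(\<Sum>j. ennreal (V * (diameter (C j) / 2) ^ k))
        = (\<Sum>j<N^k. ennreal (V * (diameter (C j) / 2) ^ k))"
      using k by (intro suminf_finite) (auto simp: C_def power_0_left)
    also have "\<dots> \<le> (\<Sum>j<N^k. ennreal (V * (M * real k / real N) ^ k))"
    proof (intro sum_mono ennreal_leI mult_left_mono power_mono V)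
      fix j assume "j \<in> {..<N^k}"
      then show "diameter (C j) / 2 \<le> M * real k / real N"
        using celld[of "e j"] by (simp add: C_def mult_ac)
      show "0 \<le> diameter (C j) / 2" using dC[of j] diameter_ge_0[of "C j"] by simp
    qed
    also have "\<dots> = ennreal (\<Sum>j<N^k. V * (M * real k / real N) ^ k)"
      using V M by (intro sum_ennreal) auto
    also have "\<dots> = b" using N by (simp add: b_def power_divide mult_ac)
    finally have "(\<Sum>j. ennreal (V * (diameter (C j) / 2) ^ k)) \<le> b" .
    then show "(INF C\<in>{C. {x :: real^'k. \<forall>i. \<bar>x $ i\<bar> \<le> M} \<subseteq> (\<Union>i. C i) \<and>
            (\<forall>i. bounded (C i) \<and> diameter (C i) \<le> \<delta>)}.
        \<Sum>i. ennreal (unit_ball_vol (real k) * (diameter (C i) / 2) ^ k)) \<le> b"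
      using cov dC by (intro INF_lower2[of C]) (auto simp: V_def)
  qed
  then show ?thesis by (auto simp: b_def k_def ennreal_less_top intro: le_less_trans)
qed

section \<open>Translation-invariant measures\<close>

text \<open>
  Haar uniqueness by Fubini. Integrate \<open>indicator A x * indicator Q (y - x)\<close>, with \<open>Q\<close> the unit cube,
  against \<open>\<mu> \<otimes> lborel\<close>. Integrating over \<open>y\<close> first gives \<open>emeasure \<mu> A\<close>. Shifting \<open>x\<close> by \<open>y\<close> in
  the \<open>\<mu>\<close>-integral and then integrating over \<open>y\<close> first gives \<open>emeasure lborel A * emeasure \<mu> (- Q)\<close>,
  and \<open>- Q\<close> is the cube \<open>cbox (- One) 0\<close>.
\<close>

lemma translation_invariant_eq_lborel:
  fixes \<mu> :: "'a::euclidean_space measure"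
  assumes [measurable_cong, simp]: "sets \<mu> = sets borel"
    and fin: "sigma_finite_measure \<mu>"
    and inv: "\<And>a. distr \<mu> borel ((+) a) = \<mu>"
    and A[measurable]: "A \<in> sets borel"
  shows "emeasure \<mu> A = emeasure \<mu> (cbox (- One) 0) * emeasure lborel A"
proof -
  interpret \<mu>: sigma_finite_measure \<mu> by (fact fin)
  interpret pair_sigma_finite lborel \<mu> ..
  define Q where "Q = (cbox 0 One :: 'a set)"
  have [measurable]: "Q \<in> sets borel" by (simp add: Q_def)
  have cont: "(\<lambda>x. indicator B (g x) :: ennreal) \<in> borel_measurable M"
    if "g \<in> M \<rightarrow>\<^sub>M borel" "B \<in> sets borel" for B :: "'a set" and g and M :: "'b measure"
    using that by (auto intro: borel_measurable_indicator')
  have Q1: "emeasure lborel Q = 1" by (simp add: Q_def emeasure_lborel_cbox_eq)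
  have "emeasure \<mu> A = (\<integral>\<^sup>+x. indicator A x * (\<integral>\<^sup>+y. indicator Q y \<partial>lborel) \<partial>\<mu>)"
    using Q1 by simp
  also have "\<dots> = (\<integral>\<^sup>+x. indicator A x * (\<integral>\<^sup>+y. indicator Q (- x + y) \<partial>lborel) \<partial>\<mu>)"
  proof (rule nn_integral_cong)
    fix x
    have "(\<integral>\<^sup>+y. indicator Q y \<partial>distr lborel borel ((+) (- x))) = (\<integral>\<^sup>+y. indicator Q (- x + y) \<partial>lborel)"
      by (subst nn_integral_distr) (auto intro!: cont)
    then show "indicator A x * (\<integral>\<^sup>+y. indicator Q y \<partial>lborel)
        = indicator A x * (\<integral>\<^sup>+y. indicator Q (- x + y) \<partial>lborel)"
      by (simp add: lborel_distr_plus)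
  qed
  also have "\<dots> = (\<integral>\<^sup>+x. \<integral>\<^sup>+y. indicator A x * indicator Q (- x + y) \<partial>lborel \<partial>\<mu>)"
    by (intro nn_integral_cong nn_integral_cmult[symmetric] cont) auto
  also have "\<dots> = (\<integral>\<^sup>+y. \<integral>\<^sup>+x. indicator A x * indicator Q (- x + y) \<partial>\<mu> \<partial>lborel)"
    by (intro Fubini') (auto intro!: cont borel_measurable_times_ennreal simp: split_beta')
  also have "\<dots> = (\<integral>\<^sup>+y. \<integral>\<^sup>+x. indicator A (y + x) * indicator Q (- x) \<partial>\<mu> \<partial>lborel)"
  proof (rule nn_integral_cong)
    fix y
    have "(\<integral>\<^sup>+x. indicator A x * indicator Q (- x + y) \<partial>distr \<mu> borel ((+) y))
       = (\<integral>\<^sup>+x. indicator A (y + x) * indicator Q (- (y + x) + y) \<partial>\<mu>)"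
      by (subst nn_integral_distr) (auto intro!: cont borel_measurable_times_ennreal)
    then show "(\<integral>\<^sup>+x. indicator A x * indicator Q (- x + y) \<partial>\<mu>)
        = (\<integral>\<^sup>+x. indicator A (y + x) * indicator Q (- x) \<partial>\<mu>)"
      by (simp add: inv)
  qed
  also have "\<dots> = (\<integral>\<^sup>+x. \<integral>\<^sup>+y. indicator A (y + x) * indicator Q (- x) \<partial>lborel \<partial>\<mu>)"
    by (intro Fubini'[symmetric]) (auto intro!: cont borel_measurable_times_ennreal simp: split_beta')
  also have "\<dots> = (\<integral>\<^sup>+x. emeasure lborel A * indicator Q (- x) \<partial>\<mu>)"
  proof (rule nn_integral_cong)
    fix x
    have "(\<integral>\<^sup>+y. indicator A y \<partial>distr lborel borel ((+) x)) = (\<integral>\<^sup>+y. indicator A (x + y) \<partial>lborel)"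
      by (subst nn_integral_distr) (auto intro!: cont)
    then have "(\<integral>\<^sup>+y. indicator A (x + y) \<partial>lborel) = emeasure lborel A"
      by (simp add: lborel_distr_plus)
    then show "(\<integral>\<^sup>+y. indicator A (y + x) * indicator Q (- x) \<partial>lborel)
        = emeasure lborel A * indicator Q (- x)"
      by (subst nn_integral_multc) (auto intro!: cont simp: add.commute)
  qed
  also have "\<dots> = emeasure lborel A * (\<integral>\<^sup>+x. indicator Q (- x) \<partial>\<mu>)"
    by (intro nn_integral_cmult cont) auto
  also have "(\<integral>\<^sup>+x. indicator Q (- x) \<partial>\<mu>) = (\<integral>\<^sup>+x. indicator (cbox (- One) 0) x \<partial>\<mu>)"
    by (intro nn_integral_cong) (auto simp: indicator_def Q_def mem_box)
  finally show ?thesis by (simp add: mult.commute)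
qed

section \<open>The area formula for affine maps\<close>

text \<open>
  Images of Borel sets need not be Borel in general; here the image is cut out of a closed subspace
  by the preimage under a continuous left inverse.
\<close>

lemma sets_borel_injective_linear_image:
  fixes L :: "'a::euclidean_space \<Rightarrow> 'b::euclidean_space"
  assumes L: "linear L" "inj L" and B: "B \<in> sets borel"
  shows "(\<lambda>x. a + L x) ` B \<in> sets borel"
proof -
  obtain g where g: "linear g" "g \<circ> L = id"
    using linear_injective_left_inverse[OF L] by blast
  have [measurable]: "g \<in> borel_measurable borel"
    using g(1) by (simp add: borel_measurable_continuous_onI linear_continuous_on linear_conv_bounded_linear)
  have gL: "g (L x) = x" for x using g(2) by (metis comp_apply id_apply)
  have "(\<lambda>x. a + L x) ` B = (\<lambda>y. y - a) -` (range L \<inter> g -` B)"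
    using gL by (force simp: image_iff algebra_simps)
  moreover have [measurable]: "range L \<in> sets borel"
    using L by (simp add: closed_subspace linear_subspace_image borel_closed)
  have "g -` B \<in> sets borel" using B by (intro measurable_sets_borel[of g]) auto
  then have "range L \<inter> g -` B \<in> sets borel" by simp
  then have "(\<lambda>y. y - a) -` (range L \<inter> g -` B) \<in> sets borel"
    by (intro measurable_sets_borel[of "\<lambda>y. y - a" borel]) auto
  ultimately show ?thesis by simp
qed

lemma hausdorff_finite_isometric_image:
  fixes Q :: "real^'k \<Rightarrow> real^'n"
  assumes Q: "linear Q" "\<And>x. norm (Q x) = norm x" and B: "bounded B" "B \<in> sets borel"
  shows "emeasure (hausdorff CARD('k)) (Q ` B) < \<infinity>"
proof -
  obtain M where M: "M \<ge> 0" "\<And>x. x \<in> B \<Longrightarrow> norm x \<le> M"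
    using B(1) by (metis bounded_pos less_le)
  define C where "C = {x :: real^'k. \<forall>i. \<bar>x $ i\<bar> \<le> M}"
  have "closed C" unfolding C_def by (intro closed_Collect_all closed_Collect_le continuous_intros)
  then have C: "C \<in> sets borel" by auto
  have inj: "inj Q" using Q linear_injective_0[of Q] by (metis norm_eq_zero)
  have d: "dist (Q x) (Q y) = dist x y" for x y
    using Q by (simp add: dist_norm flip: linear_diff)
  have bQ: "Q ` A \<in> sets borel" if "A \<in> sets borel" for A
    using sets_borel_injective_linear_image[OF Q(1) inj that, of 0] by simp
  have "emeasure (hausdorff CARD('k)) (Q ` B) \<le> emeasure (hausdorff CARD('k)) (Q ` C)"
    using M B C by (intro emeasure_mono image_mono)
      (auto simp: C_def bQ intro: order_trans[OF component_le_norm_cart])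
  also have "\<dots> \<le> hausdorff_outer CARD('k) (Q ` C)"
    using emeasure_hausdorff[of "CARD('k)", where 'a="real^'n"] bQ[OF C] by auto
  also have "\<dots> \<le> hausdorff_outer CARD('k) C"
    by (rule hausdorff_outer_contraction) (simp add: d)
  also have "\<dots> < \<infinity>" unfolding C_def by (rule hausdorff_outer_cube_finite[OF M(1)])
  finally show ?thesis .
qed

text \<open>
  Pulling the Hausdorff measure back along one isometric embedding gives a translation-invariant,
  locally finite measure on \<open>real^'k\<close>, hence a multiple of Lebesgue measure. By isometry invariance
  the factor \<open>c\<close> is the same for all isometric embeddings, so it cancels whenever
  measures in two planes are compared.
\<close>

lemma hausdorff_isometric_image:
  obtains c :: real where "c \<ge> 0"
    and "\<And>Q (B :: (real^'k) set) (a :: real^'n). linear Q \<Longrightarrow> (\<And>x. norm (Q x) = norm x) \<Longrightarrow> B \<in> sets borel \<Longrightarrow>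
          emeasure (hausdorff CARD('k)) ((\<lambda>x. a + Q x) ` B) = ennreal c * emeasure lborel B"
proof (cases "\<exists>Q :: real^'k \<Rightarrow> real^'n. linear Q \<and> (\<forall>x. norm (Q x) = norm x)")
  case False
  \<comment> \<open>If \<open>real^'k\<close> does not embed into \<open>real^'n\<close>, the formula holds vacuously.\<close>
  show ?thesis using False by (intro that[of 0]) auto
next
  case True
  let ?H = "hausdorff CARD('k) :: (real^'n) measure"
  obtain Q0 :: "real^'k \<Rightarrow> real^'n" where Q0: "linear Q0" "\<And>x. norm (Q0 x) = norm x"
    using True by auto
  have inj: "inj Q" if "linear Q" "\<And>x. norm (Q x) = norm x" for Q :: "real^'k \<Rightarrow> real^'n"
    using that linear_injective_0[of Q] by (metis norm_eq_zero)
  have borel: "(\<lambda>x. a + Q x) ` B \<in> sets borel"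
    if "linear Q" "\<And>x. norm (Q x) = norm x" "B \<in> sets borel" for Q :: "real^'k \<Rightarrow> real^'n" and B a
    using that by (intro sets_borel_injective_linear_image inj)
  have same: "emeasure ?H ((\<lambda>x. a + Q x) ` B) = emeasure ?H (Q0 ` B)"
    if Q: "linear Q" "\<And>x. norm (Q x) = norm x" and B: "B \<in> sets borel" for Q a B
    using borel[OF Q B, of a] borel[OF Q0 B, of 0] Q Q0
    by (intro emeasure_hausdorff_isometric) (simp_all add: dist_norm flip: linear_diff)
  obtain g where g: "linear g" "g \<circ> Q0 = id"
    using linear_injective_left_inverse[OF Q0(1) inj[OF Q0]] by blast
  have gQ: "g (Q0 x) = x" for x using g(2) by (metis comp_apply id_apply)
  have gm[measurable]: "g \<in> borel_measurable borel"
    using g(1) by (simp add: borel_measurable_continuous_onI linear_continuous_on linear_conv_bounded_linear)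
  have rg: "range Q0 \<in> sets borel" using borel[OF Q0, of UNIV 0] by simp
  define \<mu> where "\<mu> = distr (restrict_space ?H (range Q0)) borel g"
  have sets_\<mu>: "sets \<mu> = sets borel" by (simp add: \<mu>_def)
  have em: "emeasure \<mu> B = emeasure ?H (Q0 ` B)" if "B \<in> sets borel" for B
  proof -
    have "g -` B \<inter> range Q0 = Q0 ` B" using gQ by (auto simp: image_iff)
    moreover have "emeasure (restrict_space ?H (range Q0)) (Q0 ` B) = emeasure ?H (Q0 ` B)"
      using rg by (intro emeasure_restrict_space) auto
    ultimately show ?thesis using that
      by (simp add: \<mu>_def emeasure_distr space_restrict_space measurable_restrict_space1)
  qed
  have fin: "emeasure \<mu> B \<noteq> \<infinity>" if "bounded B" "B \<in> sets borel" for B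
    using hausdorff_finite_isometric_image[OF Q0 that] em[OF that(2)] by simp
  have "sigma_finite_measure \<mu>"
  proof
    show "\<exists>A. countable A \<and> A \<subseteq> sets \<mu> \<and> \<Union> A = space \<mu> \<and> (\<forall>a\<in>A. emeasure \<mu> a \<noteq> \<infinity>)"
    proof (intro exI[of _ "range (\<lambda>n::nat. cball 0 (real n))"] conjI ballI)
      show "\<Union> (range (\<lambda>n::nat. cball (0::real^'k) (real n))) = space \<mu>"
        by (auto simp: \<mu>_def real_arch_simple)
    qed (use fin in \<open>auto simp: sets_\<mu>\<close>)
  qed
  moreover have "distr \<mu> borel ((+) a) = \<mu>" for a
  proof (rule measure_eqI)
    fix B assume "B \<in> sets (distr \<mu> borel ((+) a))"
    then have B: "B \<in> sets borel" by simp
    have B': "(+) a -` B \<in> sets borel" using B by (intro measurable_sets_borel[of "(+) a"]) auto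
    have "emeasure (distr \<mu> borel ((+) a)) B = emeasure \<mu> ((+) a -` B)"
      using B sets_\<mu> by (subst emeasure_distr) (auto simp: \<mu>_def cong: measurable_cong_sets)
    also have "\<dots> = emeasure ?H (Q0 ` ((+) a -` B))" by (rule em[OF B'])
    also have "\<dots> = emeasure ?H ((\<lambda>x. Q0 a + Q0 x) ` ((+) a -` B))"
      by (rule same[OF Q0 B', symmetric])
    also have "(\<lambda>x. Q0 a + Q0 x) ` ((+) a -` B) = Q0 ` B"
    proof -
      have "(+) a ` ((+) a -` B) = B" by (simp add: surj_plus)
      then have "Q0 ` B = (\<lambda>x. Q0 (a + x)) ` ((+) a -` B)" by (metis image_image)
      then show ?thesis by (simp add: linear_add[OF Q0(1)])
    qed
    also have "emeasure ?H (Q0 ` B) = emeasure \<mu> B" by (rule em[OF B, symmetric])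
    finally show "emeasure (distr \<mu> borel ((+) a)) B = emeasure \<mu> B" .
  qed (simp add: sets_\<mu>)
  ultimately have eq: "emeasure \<mu> B = emeasure \<mu> (cbox (- One) 0) * emeasure lborel B"
    if "B \<in> sets borel" for B
    by (rule translation_invariant_eq_lborel[OF sets_\<mu> _ _ that])
  define c where "c = measure \<mu> (cbox (- One) 0)"
  have c: "emeasure \<mu> (cbox (- One) 0) = ennreal c"
    unfolding c_def using fin[of "cbox (- One) 0"] by (intro emeasure_eq_ennreal_measure) auto
  show ?thesis
  proof (rule that[of c])
    show "c \<ge> 0" by (simp add: c_def)
    fix Q :: "real^'k \<Rightarrow> real^'n" and B :: "(real^'k) set" and a
    assume *: "linear Q" "\<And>x. norm (Q x) = norm x" "B \<in> sets borel"
    show "emeasure ?H ((\<lambda>x. a + Q x) ` B) = ennreal c * emeasure lborel B"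
      using same[OF *, of a] em[OF *(3)] eq[OF *(3)] c by simp
  qed
qed

definition gram_det :: "(real^'k \<Rightarrow> real^'n) \<Rightarrow> real" where
  "gram_det L = det (\<chi> i j. L (axis i 1) \<bullet> L (axis j 1))"

lemma gram_det_linear_endo:
  fixes R :: "real^'k \<Rightarrow> real^'k"
  shows "gram_det R = (det (matrix R))\<^sup>2"
proof -
  have "(\<chi> i j. R (axis i 1) \<bullet> R (axis j 1)) = transpose (matrix R) ** matrix R"
    by (simp add: vec_eq_iff matrix_matrix_mult_def transpose_def matrix_def inner_vec_def)
  then show ?thesis
    by (simp add: gram_det_def det_mul det_transpose power2_eq_square)
qed

lemma gram_det_isometric_comp:
  assumes "linear L" "linear L'" "\<And>x. norm (L' x) = norm (L x)"
  shows "gram_det L' = gram_det L"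
proof -
  have "L' x \<bullet> L' y = L x \<bullet> L y" for x y
    using assms(3)[of "x + y"] assms(3)[of x] assms(3)[of y]
    by (simp add: dot_norm linear_add[OF assms(1)] linear_add[OF assms(2)])
  then show ?thesis by (simp add: gram_det_def)
qed

text \<open>
  This is the QR factorisation of an injective linear map, without any triangularity of the factor \<open>R\<close>.
\<close>

lemma linear_image_decomposition:
  fixes L :: "real^'k \<Rightarrow> real^'n"
  assumes L: "linear L" "inj L"
  obtains Q :: "real^'k \<Rightarrow> real^'n" and R where
    "linear Q" "\<And>x. norm (Q x) = norm x" "linear R" "inj R" "\<And>x. L x = Q (R x)"
    "\<And>x. norm (R x) = norm (L x)"
proof -
  have dim: "dim (range L) = dim (UNIV :: (real^'k) set)"
    using L by (intro dim_image_eq) (auto intro: inj_on_subset)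
  have sub: "subspace (range L)" using L by (simp add: linear_subspace_image)
  have "\<exists>(Q :: real^'k \<Rightarrow> real^'n) g. linear Q \<and> linear g \<and> (\<forall>x. norm (Q x) = norm x)
      \<and> (\<forall>x\<in>range L. norm (g x) = norm x \<and> Q (g x) = x)"
  proof (rule isometries_subspaces[OF subspace_UNIV sub dim[symmetric]])
    fix Q :: "real^'k \<Rightarrow> real^'n" and g
    assume "linear Q" "linear g" "\<And>x. x \<in> UNIV \<Longrightarrow> norm (Q x) = norm x"
      "\<And>x. x \<in> range L \<Longrightarrow> norm (g x) = norm x" "\<And>x. x \<in> range L \<Longrightarrow> Q (g x) = x"
    then show ?thesis by (intro exI[of _ Q] exI[of _ g]) simp
  qed
  then obtain Q :: "real^'k \<Rightarrow> real^'n" and g where Q: "linear Q" and g: "linear g"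
    and nQ: "\<forall>x. norm (Q x) = norm x" and gQ: "\<forall>x\<in>range L. norm (g x) = norm x \<and> Q (g x) = x"
    by (elim exE conjE)
  have Qg: "Q (g x) = x" if "x \<in> range L" for x using bspec[OF gQ that] by simp
  show ?thesis
  proof (rule that[of Q "g \<circ> L"])
    show "linear (g \<circ> L)" using L g by (intro linear_compose)
    show "inj (g \<circ> L)"
      using L(2) inj_on_inverseI[of "range L" Q g, OF Qg] by (rule comp_inj_on)
  qed (use Q nQ gQ in auto)
qed

lemma gram_det_nonneg:
  fixes L :: "real^'k \<Rightarrow> real^'n"
  assumes L: "linear L" "inj L"
  shows "gram_det L \<ge> 0"
proof -
  obtain Q :: "real^'k \<Rightarrow> real^'n" and R where "linear Q" "\<And>x. norm (Q x) = norm x"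
    and R: "linear R" "inj R" "\<And>x. L x = Q (R x)" "\<And>x. norm (R x) = norm (L x)"
    using linear_image_decomposition[OF L] by metis
  show ?thesis
    using gram_det_isometric_comp[OF L(1) R(1,4), symmetric] by (simp add: gram_det_linear_endo)
qed

text \<open>
  Factor \<open>L = Q \<circ> R\<close> with \<open>Q\<close> an isometric embedding and \<open>R\<close> an endomorphism of \<open>real^'k\<close>. The map
  \<open>R\<close> scales Lebesgue measure by \<open>\<bar>det R\<bar>\<close>, and \<open>(det R)\<^sup>2\<close> is the Gram determinant of \<open>L\<close>
  because \<open>Q\<close> preserves inner products.
\<close>

lemma hausdorff_linear_image:
  obtains c :: real where "c \<ge> 0"
    and "\<And>L (B :: (real^'k::{finite,wellorder}) set) (a :: real^'n).
      linear L \<Longrightarrow> inj L \<Longrightarrow> bounded B \<Longrightarrow> B \<in> sets borel \<Longrightarrow>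
      emeasure (hausdorff CARD('k)) ((\<lambda>x. a + L x) ` B)
        = ennreal (c * sqrt (gram_det L)) * emeasure lborel B"
proof -
  let ?H = "hausdorff CARD('k) :: (real^'n) measure"
  obtain c :: real where c: "c \<ge> 0"
    "\<And>Q (B :: (real^'k::_) set) (a :: real^'n). linear Q \<Longrightarrow> (\<And>x. norm (Q x) = norm x) \<Longrightarrow> B \<in> sets borel \<Longrightarrow>
          emeasure ?H ((\<lambda>x. a + Q x) ` B) = ennreal c * emeasure lborel B"
    using hausdorff_isometric_image by metis
  show ?thesis
  proof (rule that[OF c(1)])
    fix L :: "real^'k::_ \<Rightarrow> real^'n" and B :: "(real^'k::_) set" and a
    assume L: "linear L" "inj L" and B: "bounded B" "B \<in> sets borel"
    obtain Q :: "real^'k::_ \<Rightarrow> real^'n" and R where Q: "linear Q" "\<And>x. norm (Q x) = norm x"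
      and R: "linear R" "inj R" and LQR: "\<And>x. L x = Q (R x)" and n: "\<And>x. norm (R x) = norm (L x)"
      using linear_image_decomposition[OF L] by metis
    have RB: "R ` B \<in> sets borel"
      using sets_borel_injective_linear_image[OF R B(2), of 0] by simp
    have g: "sqrt (gram_det L) = \<bar>det (matrix R)\<bar>"
      using gram_det_isometric_comp[OF L(1) R(1) n, symmetric] by (simp add: gram_det_linear_endo)
    have bR: "bounded (R ` B)" using B R by (simp add: bounded_linear_image linear_linear)
    have "measure lborel (R ` B) = \<bar>det (matrix R)\<bar> * measure lborel B"
      using measure_lebesgue_linear_transformation[OF B(1) _ R(1)] B RB by simp
    moreover have "emeasure lborel X = ennreal (measure lborel X)" if "bounded X" for X :: "(real^'k::_) set"
      using emeasure_bounded_finite[OF that] by (intro emeasure_eq_ennreal_measure less_imp_neq) (simp only: infinity_ennreal_def)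
    ultimately have "emeasure lborel (R ` B) = ennreal \<bar>det (matrix R)\<bar> * emeasure lborel B"
      using B(1) bR by (simp only: ennreal_mult[OF abs_ge_zero measure_nonneg])
    moreover have "(\<lambda>x. a + L x) ` B = (\<lambda>x. a + Q x) ` R ` B" by (simp add: LQR image_image)
    ultimately show "emeasure ?H ((\<lambda>x. a + L x) ` B)
        = ennreal (c * sqrt (gram_det L)) * emeasure lborel B"
      using c(2)[OF Q RB, of a] c(1) g by (simp add: ennreal_mult mult.assoc)
  qed
qed

text \<open>
  The previous formula applied to \<open>Q\<close> and to \<open>A \<circ> Q\<close>: an affine map of the ambient space scales
  the measure inside the plane \<open>a + range Q\<close> by the root of the Gram determinant of its linear part
  in orthonormal coordinates of the plane.
\<close>

lemma hausdorff_affine_map: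
  fixes Q :: "real^'k::{finite,wellorder} \<Rightarrow> real^'n" and A :: "real^'n \<Rightarrow> real^'n"
  assumes Q: "linear Q" "\<And>x. norm (Q x) = norm x" and A: "linear A" "inj (A \<circ> Q)"
    and E: "E \<subseteq> range (\<lambda>y. a + Q y)" "bounded E" "E \<in> sets borel"
  shows "(\<lambda>p. A p + b) ` E \<in> sets borel"
    and "emeasure (hausdorff CARD('k)) E < \<infinity>"
    and "emeasure (hausdorff CARD('k)) ((\<lambda>p. A p + b) ` E)
      = ennreal (sqrt (gram_det (A \<circ> Q))) * emeasure (hausdorff CARD('k)) E"
proof -
  obtain c :: real where c: "c \<ge> 0"
    "\<And>L (B :: (real^'k::_) set) (a :: real^'n). linear L \<Longrightarrow> inj L \<Longrightarrow> bounded B \<Longrightarrow> B \<in> sets borel \<Longrightarrow>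
      emeasure (hausdorff CARD('k)) ((\<lambda>x. a + L x) ` B)
        = ennreal (c * sqrt (gram_det L)) * emeasure lborel B"
    using hausdorff_linear_image by metis
  have injQ: "inj Q" using Q linear_injective_0[of Q] by (metis norm_eq_zero)
  define B where "B = (\<lambda>y. a + Q y) -` E"
  have EB: "E = (\<lambda>y. a + Q y) ` B" using E(1) unfolding B_def by blast
  have "continuous_on UNIV (\<lambda>y. a + Q y)"
    using Q(1) by (intro continuous_intros linear_continuous_on) (simp add: linear_conv_bounded_linear)
  then have B: "B \<in> sets borel" unfolding B_def
    using E(3) by (intro measurable_sets_borel[OF borel_measurable_continuous_onI])
  obtain M where M: "\<And>x. x \<in> E \<Longrightarrow> norm x \<le> M" using E(2) by (auto simp: bounded_iff)
  have "norm y \<le> M + norm a" if "y \<in> B" for y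
  proof -
    have "norm (a + Q y) \<le> M" using that M by (auto simp: B_def)
    then show ?thesis using norm_triangle_ineq4[of "a + Q y" a] Q(2)[of y] by simp
  qed
  then have bB: "bounded B" by (auto simp: bounded_iff)
  have AQ: "linear (A \<circ> Q)" using Q A by (intro linear_compose)
  have im: "(\<lambda>p. A p + b) ` E = (\<lambda>y. (A a + b) + (A \<circ> Q) y) ` B"
    by (simp add: EB image_image linear_add[OF A(1)] algebra_simps)
  show "(\<lambda>p. A p + b) ` E \<in> sets borel"
    unfolding im by (rule sets_borel_injective_linear_image[OF AQ A(2) B])
  have "gram_det Q = gram_det (\<lambda>x :: real^'k::_. x)"
    using Q by (intro gram_det_isometric_comp) (auto simp: linear_ident)
  also have "\<dots> = 1" by (simp add: gram_det_linear_endo matrix_id[unfolded id_def])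
  finally have HE: "emeasure (hausdorff CARD('k)) E = ennreal c * emeasure lborel B"
    using c(2)[OF Q(1) injQ bB B, of a] by (simp add: EB)
  then show "emeasure (hausdorff CARD('k)) E < \<infinity>"
    using emeasure_bounded_finite[OF bB] by (simp add: ennreal_mult_less_top)
  have "0 \<le> sqrt (gram_det (A \<circ> Q))" using gram_det_nonneg[OF AQ A(2)] by simp
  then show "emeasure (hausdorff CARD('k)) ((\<lambda>p. A p + b) ` E)
      = ennreal (sqrt (gram_det (A \<circ> Q))) * emeasure (hausdorff CARD('k)) E"
    unfolding im c(2)[OF AQ A(2) bB B] HE using c(1)
    by (simp add: ennreal_mult mult_ac)
qed

text \<open>
  Integral form of the preceding scaling law: restricted to the image of \<open>E\<close>, the Hausdorff measure is the
  image of its restriction to \<open>E\<close> with density \<open>sqrt (gram_det (A \<circ> Q))\<close>.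
\<close>

lemma set_integral_affine_map:
  fixes Q :: "real^'k::{finite,wellorder} \<Rightarrow> real^'n" and A :: "real^'n \<Rightarrow> real^'n"
    and f :: "real^'n \<Rightarrow> real"
  assumes Q: "linear Q" "\<And>x. norm (Q x) = norm x" and A: "linear A" "inj (A \<circ> Q)"
    and E: "E \<subseteq> range (\<lambda>y. a + Q y)" "bounded E" "E \<in> sets borel"
    and f: "set_borel_measurable borel ((\<lambda>p. A p + b) ` E) f"
  shows "(LINT x:(\<lambda>p. A p + b) ` E|hausdorff CARD('k). f x)
    = (LINT x:E|hausdorff CARD('k). sqrt (gram_det (A \<circ> Q)) * f (A x + b))"
proof -
  let ?H = "hausdorff CARD('k) :: (real^'n) measure"
  define J where "J = sqrt (gram_det (A \<circ> Q))"
  define \<Psi> where "\<Psi> p = A p + b" for p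
  define F where "F = \<Psi> ` E"
  have area: "\<Psi> ` E' \<in> sets borel" "emeasure ?H (\<Psi> ` E') = ennreal J * emeasure ?H E'"
    if "E' \<subseteq> range (\<lambda>y. a + Q y)" "bounded E'" "E' \<in> sets borel" for E'
    using hausdorff_affine_map(1,3)[OF Q A that, of b] by (simp_all add: \<Psi>_def[abs_def] J_def)
  have F: "F \<in> sets borel" unfolding F_def by (rule area(1)[OF E])
  have cont: "continuous_on UNIV \<Psi>" unfolding \<Psi>_def
    using A(1) by (intro continuous_intros linear_continuous_on) (simp add: linear_conv_bounded_linear)
  then have \<Psi>m[measurable]: "\<Psi> \<in> borel_measurable borel" by (rule borel_measurable_continuous_onI)
  have injE: "inj_on \<Psi> E"
  proof
    fix x y assume "x \<in> E" "y \<in> E" "\<Psi> x = \<Psi> y"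
    then obtain u v where uv: "x = a + Q u" "y = a + Q v" using E(1) by blast
    then have "(A \<circ> Q) u = (A \<circ> Q) v"
      using \<open>\<Psi> x = \<Psi> y\<close> by (simp add: \<Psi>_def linear_add[OF A(1)])
    then show "x = y" using injD[OF A(2), of u v] uv by simp
  qed
  have J: "J \<ge> 0" using gram_det_nonneg[OF linear_compose[OF Q(1) A(1)] A(2)] by (simp add: J_def)
  define N where "N = density ?H (\<lambda>x. ennreal (J * indicator E x))"
  define f' where "f' x = indicator F x * f x" for x
  have f'm: "f' \<in> borel_measurable borel"
    using f by (simp add: set_borel_measurable_def f'_def[abs_def] F_def \<Psi>_def)
  have f'E: "f' (\<Psi> x) = f (\<Psi> x)" if "x \<in> E" for x using that by (simp add: f'_def F_def)
  have "density ?H (indicator F) = distr N borel \<Psi>"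
  proof (rule measure_eqI)
    fix X assume "X \<in> sets (density ?H (indicator F))"
    then have X: "X \<in> sets borel" by simp
    define E' where "E' = E \<inter> \<Psi> -` X"
    have E': "E' \<subseteq> range (\<lambda>y. a + Q y)" "bounded E'" "E' \<in> sets borel"
      using E X measurable_sets_borel[OF \<Psi>m X] by (auto simp: E'_def intro: bounded_subset)
    have "emeasure (density ?H (indicator F)) X = (\<integral>\<^sup>+x. indicator F x * indicator X x \<partial>?H)"
      using X F by (intro emeasure_density) auto
    also have "\<dots> = (\<integral>\<^sup>+x. indicator (F \<inter> X) x \<partial>?H)"
      by (simp add: indicator_inter_arith)
    also have "\<dots> = emeasure ?H (F \<inter> X)"
      using X F by (intro nn_integral_indicator) simp
    also have "F \<inter> X = \<Psi> ` E'" by (auto simp: F_def E'_def)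
    also have "emeasure ?H (\<Psi> ` E') = ennreal J * emeasure ?H E'" by (rule area(2)[OF E'])
    also have "\<dots> = emeasure N (\<Psi> -` X)"
    proof -
      have "emeasure N (\<Psi> -` X)
          = (\<integral>\<^sup>+x. ennreal (J * indicator E x) * indicator (\<Psi> -` X) x \<partial>?H)"
        unfolding N_def using E(3) measurable_sets_borel[OF \<Psi>m X]
        by (intro emeasure_density) auto
      also have "\<dots> = (\<integral>\<^sup>+x. ennreal J * indicator E' x \<partial>?H)"
        by (intro nn_integral_cong) (auto simp: E'_def indicator_def)
      also have "\<dots> = ennreal J * emeasure ?H E'"
        using E'(3) by (intro nn_integral_cmult_indicator) simp
      finally show ?thesis by simp
    qed
    also have "\<dots> = emeasure (distr N borel \<Psi>) X"
      using X by (subst emeasure_distr) (auto simp: N_def)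
    finally show "emeasure (density ?H (indicator F)) X = emeasure (distr N borel \<Psi>) X" .
  qed simp
  moreover have "integral\<^sup>L (density ?H (indicator F)) f' = (LINT x:F|?H. f x)"
  proof -
    have "integral\<^sup>L (density ?H (\<lambda>x. ennreal (indicator F x))) f' = (LINT x|?H. indicator F x *\<^sub>R f' x)"
      using f'm F by (intro integral_density) auto
    also have "\<dots> = (LINT x:F|?H. f x)"
      unfolding set_lebesgue_integral_def
      by (intro Bochner_Integration.integral_cong refl) (auto simp: f'_def indicator_def)
    finally show ?thesis by (simp add: ennreal_indicator)
  qed
  moreover have "integral\<^sup>L (distr N borel \<Psi>) f' = (LINT x:E|?H. J * f (\<Psi> x))"
  proof -
    have "integral\<^sup>L (distr N borel \<Psi>) f' = integral\<^sup>L N (\<lambda>x. f' (\<Psi> x))"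
      using f'm by (intro integral_distr) (auto simp: N_def)
    also have "\<dots> = (LINT x|?H. (J * indicator E x) *\<^sub>R f' (\<Psi> x))"
      unfolding N_def using f'm E(3) J
      by (intro integral_density) (auto intro: measurable_compose[OF \<Psi>m])
    also have "\<dots> = (LINT x:E|?H. J * f (\<Psi> x))"
      unfolding set_lebesgue_integral_def
      by (intro Bochner_Integration.integral_cong refl) (auto simp: f'E indicator_def)
    finally show ?thesis .
  qed
  ultimately show ?thesis by (simp add: F_def \<Psi>_def J_def)
qed

text \<open>
  In coordinates of the plane this set is contained in the frontier of a convex set, which is
  a Lebesgue null set.
\<close>

lemma hausdorff_closure_minus_rel_interior:
  fixes Q :: "real^'k::{finite,wellorder} \<Rightarrow> real^'n"
  assumes Q: "linear Q" "\<And>x. norm (Q x) = norm x"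
    and E: "convex E" "E \<subseteq> range (\<lambda>y. a + Q y)" "bounded E"
  shows "emeasure (hausdorff CARD('k)) (closure E - rel_interior E) = 0"
proof -
  obtain c :: real where c: "c \<ge> 0"
    "\<And>Q (B :: (real^'k::_) set) (a :: real^'n). linear Q \<Longrightarrow> (\<And>x. norm (Q x) = norm x) \<Longrightarrow> B \<in> sets borel \<Longrightarrow>
          emeasure (hausdorff CARD('k)) ((\<lambda>x. a + Q x) ` B) = ennreal c * emeasure lborel B"
    using hausdorff_isometric_image by metis
  have injQ: "inj Q" using Q linear_injective_0[of Q] by (metis norm_eq_zero)
  have cl: "closed (range (\<lambda>y. a + Q y))"
  proof -
    have "closed (range Q)" using Q by (simp add: closed_subspace linear_subspace_image)
    then have "closed ((+) a ` range Q)" by (rule closed_translation)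
    then show ?thesis by (simp add: image_image)
  qed
  define C where "C = (\<lambda>y. a + Q y) -` closure E"
  have EC: "closure E = (\<lambda>y. a + Q y) ` C"
    using closure_minimal[OF E(2) cl] unfolding C_def by blast
  have "convex (Q -` ((\<lambda>x. - a + x) ` closure E))"
    using E(1) Q(1) by (intro convex_linear_vimage convex_translation convex_closure)
  moreover have "Q -` ((\<lambda>x. - a + x) ` closure E) = C"
  proof (intro set_eqI)
    fix y
    have "Q y = - a + x \<longleftrightarrow> x = a + Q y" for x by (auto simp: algebra_simps)
    then show "y \<in> Q -` ((\<lambda>x. - a + x) ` closure E) \<longleftrightarrow> y \<in> C" by (auto simp: C_def image_iff)
  qed
  ultimately have C: "convex C" by simp
  have "rel_interior E = rel_interior (closure E)" using E(1) by (simp add: convex_rel_interior_closure)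
  also have "\<dots> = rel_interior ((+) a ` Q ` C)" by (simp add: EC image_image)
  also have "\<dots> = (+) a ` Q ` rel_interior C"
    by (simp only: rel_interior_translation rel_interior_convex_linear_image[OF Q(1) C])
  also have "\<dots> = (\<lambda>y. a + Q y) ` rel_interior C" by (simp add: image_image)
  finally have "rel_interior E = (\<lambda>y. a + Q y) ` rel_interior C" .
  moreover have "C - rel_interior C \<subseteq> frontier C"
    using interior_subset_rel_interior[of C] closure_subset[of C] by (auto simp: frontier_def)
  ultimately have "closure E - rel_interior E \<subseteq> (\<lambda>y. a + Q y) ` frontier C"
    unfolding EC by blast
  moreover have "emeasure lborel (frontier C) = 0"
    using negligible_convex_frontier[OF C]
    by (simp add: negligible_iff_null_sets null_sets_def borel_closed)
  then have "emeasure (hausdorff CARD('k)) ((\<lambda>y. a + Q y) ` frontier C) = 0"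
    using c(2)[OF Q, of "frontier C" a] by (simp add: borel_closed)
  ultimately show ?thesis
    using sets_borel_injective_linear_image[OF Q(1) injQ, of "frontier C" a]
    by (auto simp: borel_closed intro: emeasure_eq_0)
qed

section \<open>Tangential gradients and determinants on subspaces\<close>

lemma det_reindex:
  fixes \<beta> :: "'k::finite \<Rightarrow> 'a" and M :: "'a \<Rightarrow> 'a \<Rightarrow> real"
  assumes \<beta>: "bij_betw \<beta> UNIV B"
  shows "(\<Sum>\<pi>\<in>{\<pi>. \<pi> permutes B}. of_int (sign \<pi>) * (\<Prod>b\<in>B. M b (\<pi> b)))
    = det (\<chi> i j. M (\<beta> i) (\<beta> j))"
proof -
  define f where "f \<pi> = (\<lambda>x. if x \<in> B then \<beta> (\<pi> (inv_into UNIV \<beta> x)) else x)" for \<pi>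
  have B: "B = range \<beta>" and inj: "inj \<beta>" using \<beta> by (auto simp: bij_betw_def)
  have f: "bij_betw f {\<pi>. \<pi> permutes UNIV} {\<pi>. \<pi> permutes B}"
    unfolding f_def by (rule bij_betw_permutations[OF \<beta>])
  have "sign (f \<pi>) = sign \<pi>" if "\<pi> permutes UNIV" for \<pi>
  proof -
    have "f \<pi> = map_permutation UNIV \<beta> \<pi>"
      by (auto simp: f_def map_permutation_def restrict_id_def B fun_eq_iff)
    then show ?thesis using that inj by (simp add: sign_map_permutation)
  qed
  moreover have "(\<Prod>b\<in>B. M b (f \<pi> b)) = (\<Prod>i\<in>UNIV. M (\<beta> i) (\<beta> (\<pi> i)))" for \<pi>
    unfolding B by (subst prod.reindex[OF inj]) (simp add: f_def B inj)
  ultimately show ?thesis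
    unfolding det_def sum.reindex_bij_betw[OF f, symmetric] by (intro sum.cong) auto
qed

text \<open>
  The frame \<open>Q\<close> enumerates by the index type \<open>'k\<close> the very basis that is chosen in the definition of
  \<open>det_on\<close>. Hence the Leibniz formula over basis vectors becomes an ordinary determinant.
\<close>

lemma det_on_orthonormal_frame:
  fixes S :: "(real^'n) set"
  assumes S: "subspace S" "dim S = CARD('k::finite)"
  obtains Q :: "real^'k \<Rightarrow> real^'n" where
    "linear Q" "\<And>x. norm (Q x) = norm x" "range Q = S"
    "\<And>L. det_on S L = det (\<chi> i j. Q (axis i 1) \<bullet> L (Q (axis j 1)))"
proof -
  define P where "P B \<longleftrightarrow> pairwise orthogonal B \<and> (\<forall>b\<in>B. norm b = 1) \<and> span B = S"
    for B :: "(real^'n) set"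
  define B where "B = (SOME B. P B)"
  have "\<exists>B. P B" using orthonormal_basis_subspace[OF S(1)] unfolding P_def by metis
  then have "P B" unfolding B_def by (rule someI_ex)
  then have B: "pairwise orthogonal B" "\<And>b. b \<in> B \<Longrightarrow> norm b = 1" "span B = S"
    by (auto simp: P_def)
  have ind: "independent B" using B(2)[of 0] by (intro pairwise_orthogonal_independent[OF B(1)]) auto
  then have "finite B" "card B = CARD('k)"
    using indep_card_eq_dim_span[OF ind] B(3) S by auto
  then obtain \<beta> :: "'k \<Rightarrow> real^'n" where \<beta>: "bij_betw \<beta> UNIV B"
    using finite_same_card_bij[of "UNIV :: 'k set" B] by auto
  have orth: "\<beta> i \<bullet> \<beta> j = (if i = j then 1 else 0)" for i j
  proof (cases "i = j")
    case True
    have "\<beta> i \<in> B" using \<beta> by (auto simp: bij_betw_def)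
    then show ?thesis using B(2)[of "\<beta> i"] True by (simp add: dot_square_norm)
  next
    case False
    then have "\<beta> i \<in> B" "\<beta> j \<in> B" "\<beta> i \<noteq> \<beta> j" using \<beta> by (auto simp: bij_betw_def dest: injD)
    then show ?thesis using B(1) False by (auto simp: pairwise_def orthogonal_def)
  qed
  define Q :: "real^'k \<Rightarrow> real^'n" where "Q y = (\<Sum>i\<in>UNIV. (y $ i) *\<^sub>R \<beta> i)" for y
  have lin: "linear Q"
    by (rule linearI) (simp_all add: Q_def scaleR_left_distrib sum.distrib scaleR_sum_right)
  have Qax: "Q (axis i 1) = \<beta> i" for i
    unfolding Q_def axis_def by (simp add: if_distrib[of "\<lambda>c. c *\<^sub>R _"] cong: if_cong)
  have "(norm (Q y))\<^sup>2 = (norm y)\<^sup>2" for y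
  proof -
    have "(norm (Q y))\<^sup>2 = (\<Sum>i\<in>UNIV. \<Sum>j\<in>UNIV. y $ i * (y $ j * (\<beta> j \<bullet> \<beta> i)))"
      by (simp add: dot_square_norm[symmetric] Q_def inner_sum_left inner_sum_right sum_distrib_left)
    also have "\<dots> = (\<Sum>i\<in>UNIV. y $ i * y $ i)"
      by (simp add: orth if_distrib[of "\<lambda>c. _ * (_ * c)"] cong: if_cong)
    also have "\<dots> = (norm y)\<^sup>2" by (simp add: dot_square_norm[symmetric] inner_vec_def)
    finally show ?thesis .
  qed
  then have nrm: "norm (Q y) = norm y" for y by simp
  have "range Q = S"
  proof
    show "range Q \<subseteq> S"
    proof -
      have "\<beta> i \<in> S" for i using \<beta> B(3) span_superset[of B] by (auto simp: bij_betw_def)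
      then show ?thesis using S(1) by (auto simp: Q_def intro!: subspace_sum subspace_scale)
    qed
    have "subspace (range Q)" using lin by (simp add: linear_subspace_image)
    moreover have "B \<subseteq> range Q" using \<beta> Qax by (auto simp: bij_betw_def image_iff) metis
    ultimately show "S \<subseteq> range Q" using B(3) span_minimal by blast
  qed
  moreover have "det_on S L = det (\<chi> i j. Q (axis i 1) \<bullet> L (Q (axis j 1)))" for L
    using det_reindex[OF \<beta>, of "\<lambda>b c. b \<bullet> L c"]
    unfolding det_on_def Let_def P_def[symmetric] B_def[symmetric] Qax .
  ultimately show ?thesis using that lin nrm by blast
qed

text \<open>
  Two derivatives within a relatively open set agree in all directions along which one can move
  inside the set. The difference \<open>w\<close> of two tangential gradients is such a direction, and the two derivatives
  agree along \<open>w\<close> only if \<open>w \<bullet> w = 0\<close>.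
\<close>

lemma tangential_derivative_unique:
  fixes g :: "real^'n"
  assumes g: "g \<in> span ((\<lambda>x. x - a) ` C)" "g' \<in> span ((\<lambda>x. x - a) ` C)" and a: "a \<in> affine hull C"
    and p: "p \<in> rel_interior C"
    and "(u has_derivative (\<lambda>h. g \<bullet> h)) (at p within rel_interior C)"
    and "(u has_derivative (\<lambda>h. g' \<bullet> h)) (at p within rel_interior C)"
  shows "g = g'"
proof -
  define w where "w = g - g'"
  have w: "w \<in> span ((\<lambda>x. x - a) ` C)" using g by (simp add: w_def span_diff)
  have hull: "affine hull C = (\<lambda>x. a + x) ` span ((\<lambda>x. x - a) ` C)"
    using affine_hull_span_gen[OF a] by simp
  obtain e where e: "e > 0" "ball p e \<inter> affine hull C \<subseteq> C" and pC: "p \<in> C"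
    using p by (auto simp: mem_rel_interior_ball)
  \<comment> \<open>Adding 1 keeps the denominator positive before \<open>w = 0\<close> is known.\<close>
  define \<delta> where "\<delta> = e / (norm w + 1)"
  have \<delta>: "\<delta> > 0" using e by (simp add: \<delta>_def add_nonneg_pos)
  have mem: "p + t *\<^sub>R w \<in> rel_interior C" if "t \<in> ball 0 \<delta>" for t
  proof -
    have "norm (t *\<^sub>R w) < e"
    proof -
      have "\<bar>t\<bar> * (norm w + 1) < e" using that e(1)
        by (simp add: \<delta>_def pos_less_divide_eq add_nonneg_pos)
      moreover have "\<bar>t\<bar> * norm w \<le> \<bar>t\<bar> * (norm w + 1)" by (intro mult_left_mono) auto
      ultimately show ?thesis by simp
    qed
    moreover have "p + t *\<^sub>R w \<in> affine hull C"
    proof -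
      obtain z where "z \<in> span ((\<lambda>x. x - a) ` C)" "p = a + z"
        using hull_inc[OF pC, of affine] hull by auto
      moreover from this have "z + t *\<^sub>R w \<in> span ((\<lambda>x. x - a) ` C)"
        using w by (intro span_add span_scale)
      ultimately show ?thesis unfolding hull by (auto simp: add.assoc)
    qed
    ultimately show ?thesis
    proof -
      assume n: "norm (t *\<^sub>R w) < e" and m: "p + t *\<^sub>R w \<in> affine hull C"
      have "ball (p + t *\<^sub>R w) (e - norm (t *\<^sub>R w)) \<subseteq> ball p e"
      proof
        fix y assume "y \<in> ball (p + t *\<^sub>R w) (e - norm (t *\<^sub>R w))"
        then show "y \<in> ball p e"
          using dist_triangle[of p y "p + t *\<^sub>R w"] by (simp add: dist_norm)
      qed
      then have "ball (p + t *\<^sub>R w) (e - norm (t *\<^sub>R w)) \<inter> affine hull C \<subseteq> C" using e(2) by blast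
      moreover have "p + t *\<^sub>R w \<in> C" using n m e(2) by (auto simp: dist_norm)
      ultimately show ?thesis using n by (auto simp: mem_rel_interior_ball intro!: exI[of _ "e - norm (t *\<^sub>R w)"])
    qed
  qed
  have comp: "((\<lambda>t. u (p + t *\<^sub>R w)) has_derivative (\<lambda>t. v \<bullet> (t *\<^sub>R w))) (at 0)"
    if "(u has_derivative (\<lambda>h. v \<bullet> h)) (at p within rel_interior C)" for v
  proof -
    have "((\<lambda>t. p + t *\<^sub>R w) has_derivative (\<lambda>t. t *\<^sub>R w)) (at 0 within ball 0 \<delta>)"
      by (auto intro!: derivative_eq_intros)
    moreover have "(u has_derivative (\<lambda>h. v \<bullet> h))
        (at (p + 0 *\<^sub>R w) within (\<lambda>t. p + t *\<^sub>R w) ` ball 0 \<delta>)"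
      using has_derivative_subset[OF that, of "(\<lambda>t. p + t *\<^sub>R w) ` ball 0 \<delta>"] mem by (simp add: image_subset_iff)
    ultimately have "((\<lambda>t. u (p + t *\<^sub>R w)) has_derivative (\<lambda>t. v \<bullet> (t *\<^sub>R w))) (at 0 within ball 0 \<delta>)"
      by (rule has_derivative_in_compose)
    moreover have "at (0::real) within ball 0 \<delta> = at 0" using \<delta> by (intro at_within_open) auto
    ultimately show ?thesis by (simp only:)
  qed
  have "(\<lambda>t. g \<bullet> (t *\<^sub>R w)) = (\<lambda>t. g' \<bullet> (t *\<^sub>R w))"
    by (rule has_derivative_unique[OF comp comp]) fact+
  from fun_cong[OF this, of 1] have "w \<bullet> w = 0" by (simp add: w_def inner_diff_left)
  then show ?thesis by (simp add: w_def)
qed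

text \<open>
  The tangential gradient of an affine function is the orthogonal projection onto the tangent space of the vector
  representing its linear part. It therefore represents \<open>A\<close> on tangent vectors, and
  the Jacobian is built from such values.
\<close>

lemma tangential_gradient_affine:
  fixes A :: "real^'n \<Rightarrow> real"
  defines "S \<equiv> \<lambda>C (a::real^'n). span ((\<lambda>x. x - a) ` C)"
  assumes A: "linear A" and a: "a \<in> affine hull C" and p: "p \<in> rel_interior C"
    and u: "\<And>x. x \<in> rel_interior C \<Longrightarrow> u x = A x + b"
  shows "\<exists>g\<in>S C a. (\<forall>h\<in>S C a. g \<bullet> h = A h) \<and>
    (THE g. g \<in> S C a \<and> (u has_derivative (\<lambda>h. g \<bullet> h)) (at p within rel_interior C)) = g"
proof -
  have "\<exists>v. \<forall>h. A h = v \<bullet> h"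
    by (intro exI[of _ "adjoint A 1"]) (simp add: adjoint_works[OF A] inner_commute)
  then obtain v where v: "\<And>h. A h = v \<bullet> h" by blast
  obtain g z where g: "g \<in> span (S C a)" "\<And>w. w \<in> span (S C a) \<Longrightarrow> orthogonal z w" "v = g + z"
    using orthogonal_subspace_decomp_exists[of "S C a" v] by metis
  have gS: "g \<in> S C a" using g(1) by (simp add: S_def span_span)
  have gA: "g \<bullet> h = A h" if "h \<in> S C a" for h
    using g(2)[of h] that by (simp add: v g(3) inner_add_left orthogonal_def S_def span_span)
  have hull: "affine hull C = (\<lambda>x. a + x) ` S C a"
    using affine_hull_span_gen[OF a] by (simp add: S_def)
  have in_hull: "x \<in> affine hull C" if "x \<in> rel_interior C" for x
    using that rel_interior_subset[of C] hull_subset[of C affine] by blast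
  have "u x = u p + g \<bullet> (x - p)" if x: "x \<in> rel_interior C" for x
  proof -
    obtain h k where "h \<in> S C a" "k \<in> S C a" "x = a + h" "p = a + k"
      using in_hull[OF x] in_hull[OF p] hull by auto
    then have "x - p \<in> S C a" by (simp add: S_def span_diff)
    then show ?thesis using u[OF x] u[OF p] gA by (simp add: linear_diff[OF A])
  qed
  moreover have "((\<lambda>x. u p + g \<bullet> (x - p)) has_derivative (\<lambda>h. g \<bullet> h)) (at p within rel_interior C)"
    by (auto intro!: derivative_eq_intros)
  ultimately have der: "(u has_derivative (\<lambda>h. g \<bullet> h)) (at p within rel_interior C)"
    by (rule has_derivative_transform[OF p])
  have "(THE g. g \<in> S C a \<and> (u has_derivative (\<lambda>h. g \<bullet> h)) (at p within rel_interior C)) = g"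
    using der gS unfolding S_def
    by (intro the_equality conjI) (blast intro: tangential_derivative_unique[OF _ _ a p])+
  then show ?thesis using gS gA by blast
qed

section \<open>Geometry of polyhedral surfaces\<close>

lemma polyhedral_surface_elementD:
  fixes q :: "nat \<Rightarrow> real^'n"
  assumes "polyhedral_surface N T q" "s \<in> T"
  shows "set s \<noteq> {}" "hd s \<in> set s" "card (q ` set s) = CARD('n)" "\<not> affine_dependent (q ` set s)"
proof -
  have *: "length s = CARD('n)" "distinct s" "inj_on q (vertices T)"
    using assms unfolding polyhedral_surface_def by auto
  then have "s \<noteq> []" by auto
  then show "set s \<noteq> {}" "hd s \<in> set s" by auto
  have "inj_on q (set s)" using *(3) assms(2) by (auto simp: vertices_def intro: inj_on_subset)
  then show "card (q ` set s) = CARD('n)" using * by (simp add: card_image distinct_card)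
  show "\<not> affine_dependent (q ` set s)"
    using assms unfolding polyhedral_surface_def by auto
qed

lemma polyhedral_surfaceD:
  assumes "polyhedral_surface N T q"
  shows "finite T" "s \<in> T \<Longrightarrow> t \<in> T \<Longrightarrow> p \<in> open_simplex q s \<Longrightarrow> p \<in> open_simplex q t \<Longrightarrow> s = t"
  using assms unfolding polyhedral_surface_def by blast+

lemma elementwise_in_open_simplex:
  assumes "polyhedral_surface N T q" "s \<in> T" "p \<in> open_simplex q s"
  shows "elementwise T q F p = F s p"
proof -
  have "(THE s. s \<in> T \<and> p \<in> open_simplex q s) = s"
    using assms polyhedral_surfaceD(2)[OF assms(1)] by (intro the_equality) auto
  then show ?thesis using assms unfolding elementwise_def by auto
qed

lemma closure_open_simplex:
  "closure (open_simplex q s) = convex hull (q ` set s)"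
proof -
  have "compact (convex hull (q ` set s))" by (intro compact_convex_hull finite_imp_compact) simp
  then show ?thesis
    by (simp add: open_simplex_def convex_closure_rel_interior compact_imp_closed)
qed

lemma vertex_in_closure: "k \<in> set s \<Longrightarrow> q k \<in> closure (open_simplex q s)"
  by (simp add: closure_open_simplex hull_inc)

lemma bounded_open_simplex: "bounded (open_simplex q s)"
proof -
  have "compact (convex hull (q ` set s))" by (intro compact_convex_hull finite_imp_compact) simp
  then show ?thesis unfolding open_simplex_def
    by (rule bounded_subset[OF compact_imp_bounded rel_interior_subset])
qed

lemma convex_open_simplex: "convex (open_simplex q s)"
  by (simp add: open_simplex_def convex_rel_interior)

lemma rel_interior_open_simplex: "rel_interior (open_simplex q s) = open_simplex q s"
  using convex_rel_interior_closure[OF convex_open_simplex[of q s]]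
  by (simp add: closure_open_simplex) (simp add: open_simplex_def)

lemma borel_open_simplex: "open_simplex q s \<in> sets borel"
proof -
  have "openin (top_of_set (affine hull (convex hull (q ` set s)))) (open_simplex q s)"
    unfolding open_simplex_def by (rule openin_rel_interior)
  then obtain U where "open U" "open_simplex q s = affine hull (convex hull (q ` set s)) \<inter> U"
    by (auto simp: openin_open)
  moreover have "closed (affine hull (convex hull (q ` set s)))" by simp
  ultimately show ?thesis by auto
qed

lemma compact_surface:
  assumes "polyhedral_surface N T q"
  shows "compact (surface T q)"
proof -
  have "compact (convex hull (q ` set s))" for s
    by (intro compact_convex_hull finite_imp_compact) simp
  then show ?thesis
    unfolding surface_def closure_open_simplex
    using polyhedral_surfaceD(1)[OF assms] by (intro compact_UN) auto
qed

lemma open_simplex_subset_surface: "s \<in> T \<Longrightarrow> open_simplex q s \<subseteq> surface T q"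
  unfolding surface_def using closure_subset by blast

lemma tangent_space_alt:
  "tangent_space q s = span ((\<lambda>x. x - q (hd s)) ` (q ` set s))"
  by (simp add: tangent_space_def image_image)

lemma dim_tangent_space:
  fixes q :: "nat \<Rightarrow> real^'n"
  assumes s: "polyhedral_surface N T q" "s \<in> T" and k: "CARD('n) = Suc k"
  shows "dim (tangent_space q s) = k"
proof -
  note D = polyhedral_surface_elementD[OF s]
  have "aff_dim (q ` set s) = int (dim ((\<lambda>x. x - q (hd s)) ` (q ` set s)))"
    using D(2) by (intro aff_dim_eq_dim_subtract hull_inc) auto
  moreover have "of_nat (card (q ` set s)) = aff_dim (q ` set s) + 1"
    by (rule aff_dim_affine_independent[OF D(4)])
  ultimately show ?thesis using D(3) k by (simp add: tangent_space_alt)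
qed

lemma open_simplex_in_plane:
  assumes "hd s \<in> set s"
  shows "closure (open_simplex q s) \<subseteq> (\<lambda>h. q (hd s) + h) ` tangent_space q s"
proof -
  have "q (hd s) \<in> affine hull (q ` set s)" using assms by (intro hull_inc) auto
  then show ?thesis
    using convex_hull_subset_affine_hull[of "q ` set s"] affine_hull_span_gen[of "q (hd s)" "q ` set s"]
    by (simp add: closure_open_simplex tangent_space_alt)
qed

text \<open>
  The gradient lemmas speak of the span of all differences within a convex set, the tangent space
  is spanned by the edges at one vertex.
\<close>

lemma tangent_space_convex_hull:
  assumes "hd s \<in> set s"
  shows "tangent_space q s = span ((\<lambda>x. x - q (hd s)) ` (convex hull (q ` set s)))"
proof
  show "tangent_space q s \<subseteq> span ((\<lambda>x. x - q (hd s)) ` (convex hull (q ` set s)))"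
    unfolding tangent_space_alt by (intro span_mono image_mono hull_subset)
  have "(\<lambda>x. x - q (hd s)) ` (convex hull (q ` set s)) \<subseteq> tangent_space q s"
    using open_simplex_in_plane[OF assms, of q] by (auto simp: closure_open_simplex)
  then show "span ((\<lambda>x. x - q (hd s)) ` (convex hull (q ` set s))) \<subseteq> tangent_space q s"
    by (simp add: span_minimal tangent_space_def)
qed

lemma surf_grad_affine:
  fixes q :: "nat \<Rightarrow> real^'n" and A :: "real^'n \<Rightarrow> real"
  assumes s: "polyhedral_surface N T q" "s \<in> T" and p: "p \<in> open_simplex q s"
    and A: "linear A" and u: "\<And>x. x \<in> open_simplex q s \<Longrightarrow> u x = A x + b"
    and h: "h \<in> tangent_space q s"
  shows "surf_grad T q u p \<bullet> h = A h"
proof -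
  note D = polyhedral_surface_elementD[OF s]
  let ?C = "convex hull (q ` set s)"
  have "q (hd s) \<in> affine hull ?C" using D(2) by (simp add: hull_inc)
  from tangential_gradient_affine[OF A this, of p u b] obtain g
    where g: "\<forall>h\<in>tangent_space q s. g \<bullet> h = A h"
      "(THE g. g \<in> tangent_space q s \<and> (u has_derivative (\<lambda>h. g \<bullet> h)) (at p within open_simplex q s)) = g"
    using p u unfolding open_simplex_def tangent_space_convex_hull[OF D(2)] by blast
  then show ?thesis
    unfolding surf_grad_def elementwise_in_open_simplex[OF s p] using h by simp
qed

lemma surf_grad_vec_affine:
  fixes q :: "nat \<Rightarrow> real^'n" and A :: "real^'n \<Rightarrow> real^'n"
  assumes s: "polyhedral_surface N T q" "s \<in> T" and p: "p \<in> open_simplex q s"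
    and A: "linear A" and u: "\<And>x. x \<in> open_simplex q s \<Longrightarrow> u x = A x + b"
    and h: "h \<in> tangent_space q s"
  shows "surf_grad_vec T q u p *v h = A h"
proof (subst vec_eq_iff, rule allI)
  fix i
  have "linear (\<lambda>x. A x $ i)" using A by (auto simp: linear_iff)
  then have "surf_grad T q (\<lambda>x. u x $ i) p \<bullet> h = A h $ i"
    by (rule surf_grad_affine[OF s p _ _ h, where b = "b $ i"]) (simp add: u)
  then show "(surf_grad_vec T q u p *v h) $ i = A h $ i"
    by (simp add: surf_grad_vec_def matrix_vector_mult_def inner_vec_def)
qed

text \<open>
  With \<open>G\<close> the surface gradient of \<open>u\<close> and \<open>Q\<close> an orthonormal frame of the tangent space, the matrix of
  \<open>G\<^sup>T G\<close> has entries \<open>(G Q e\<^sub>i) \<bullet> (G Q e\<^sub>j)\<close>, and \<open>G\<close> acts on tangent vectors as the linear part \<open>A\<close>.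
  So the abstractly defined Jacobian is the scaling factor of the area formula.
\<close>

lemma surf_jacobian_affine:
  fixes q :: "nat \<Rightarrow> real^'n" and A :: "real^'n \<Rightarrow> real^'n"
  assumes s: "polyhedral_surface N T q" "s \<in> T" and k: "CARD('n) = Suc CARD('k::finite)"
    and A: "linear A" and u: "\<And>x. x \<in> open_simplex q s \<Longrightarrow> u x = A x + b"
  obtains Q :: "real^'k \<Rightarrow> real^'n" where "linear Q" "\<And>x. norm (Q x) = norm x"
    "range Q = tangent_space q s"
    "\<And>p. p \<in> open_simplex q s \<Longrightarrow> surf_jacobian T q u p = sqrt (gram_det (A \<circ> Q))"
proof -
  have "subspace (tangent_space q s)" by (simp add: tangent_space_def)
  then obtain Q :: "real^'k \<Rightarrow> real^'n" where Q: "linear Q" "\<And>x. norm (Q x) = norm x"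
    "range Q = tangent_space q s"
    "\<And>L. det_on (tangent_space q s) L = det (\<chi> i j. Q (axis i 1) \<bullet> L (Q (axis j 1)))"
    using det_on_orthonormal_frame[OF _ dim_tangent_space[OF s k]] by metis
  have "surf_jacobian T q u p = sqrt (gram_det (A \<circ> Q))" if p: "p \<in> open_simplex q s" for p
  proof -
    define G where "G = surf_grad_vec T q u p"
    have GQ: "G *v Q y = A (Q y)" for y
      unfolding G_def using Q(3) by (intro surf_grad_vec_affine[OF s p A u]) auto
    have "Q x \<bullet> ((transpose G ** G) *v Q y) = A (Q x) \<bullet> A (Q y)" for x y
      by (metis GQ dot_lmul_matrix matrix_vector_mul_assoc transpose_matrix_vector inner_commute)
    then show ?thesis
      unfolding surf_jacobian_def elementwise_in_open_simplex[OF s p]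
      by (simp add: Q(4) gram_det_def G_def[symmetric])
  qed
  then show ?thesis using that[OF Q(1-3)] by blast
qed

lemma Vh_affine_on_closure:
  fixes \<phi> :: "real^'n \<Rightarrow> 'b::real_normed_vector"
  assumes "\<phi> \<in> Vh T q" "s \<in> T"
  obtains A b where "linear A" "\<And>p. p \<in> closure (open_simplex q s) \<Longrightarrow> \<phi> p = A p + b"
proof -
  obtain A b where A: "linear A" "\<And>p. p \<in> open_simplex q s \<Longrightarrow> \<phi> p = A p + b"
    using assms unfolding Vh_def by blast
  have "continuous_on (closure (open_simplex q s)) (\<lambda>p. \<phi> p - A p)"
  proof (rule continuous_on_diff)
    show "continuous_on (closure (open_simplex q s)) \<phi>"
      using assms by (auto simp: Vh_def surface_def intro: continuous_on_subset)
    show "continuous_on (closure (open_simplex q s)) A"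
      using A(1) by (intro linear_continuous_on) (simp add: linear_conv_bounded_linear)
  qed
  then have "\<phi> p - A p = b" if "p \<in> closure (open_simplex q s)" for p
    by (rule continuous_constant_on_closure) (use A(2) that in auto)
  then show ?thesis using A(1) that by (metis add.commute diff_add_cancel)
qed

text \<open>
  The velocity is affine up to the boundary of each element by continuity, and its vertex values
  are difference quotients of the vertex positions, so the pullback sends the current vertices to the previous ones.
\<close>

lemma pullback_map_affine:
  fixes q :: "nat \<Rightarrow> real^'n"
  assumes vel: "is_mesh_velocity T q_old q \<tau> vel" and \<tau>: "\<tau> \<noteq> 0" and s: "s \<in> T"
  obtains A b where "linear A" "\<And>p. p \<in> closure (open_simplex q s) \<Longrightarrow> pullback_map \<tau> vel p = A p + b"
    "\<And>k. k \<in> set s \<Longrightarrow> A (q k) + b = q_old k"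
proof -
  obtain A b where A: "linear A" "\<And>p. p \<in> closure (open_simplex q s) \<Longrightarrow> vel p = A p + b"
    using Vh_affine_on_closure[of vel T q s] vel s unfolding is_mesh_velocity_def by metis
  define A' where "A' p = p - \<tau> *\<^sub>R A p" for p
  have A': "linear A'" unfolding A'_def
    by (intro linear_compose_sub linear_ident linear_compose_scale_right A)
  have eq: "pullback_map \<tau> vel p = A' p + - \<tau> *\<^sub>R b" if "p \<in> closure (open_simplex q s)" for p
    using A(2)[OF that] by (simp add: pullback_map_def A'_def algebra_simps)
  have "A' (q k) + - \<tau> *\<^sub>R b = q_old k" if "k \<in> set s" for k
  proof -
    have "vel (q k) = (q k - q_old k) /\<^sub>R \<tau>"
      using vel s that unfolding is_mesh_velocity_def vertices_def by blast
    then show ?thesis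
      using eq[OF vertex_in_closure[OF that]] \<tau> by (simp add: pullback_map_def)
  qed
  then show ?thesis using that[OF A' eq] by blast
qed

lemma open_simplex_affine_image:
  assumes A: "linear A" and v: "\<And>k. k \<in> set s \<Longrightarrow> A (q k) + b = q' k"
  shows "(\<lambda>p. A p + b) ` open_simplex q s = open_simplex q' s"
    and "(\<lambda>p. A p + b) ` closure (open_simplex q s) = closure (open_simplex q' s)"
proof -
  have "q' ` set s = (+) b ` A ` q ` set s" using v by (force simp: image_image add.commute)
  then have hull: "convex hull (q' ` set s) = (+) b ` A ` (convex hull (q ` set s))"
    by (simp only: convex_hull_translation convex_hull_linear_image[OF A])
  then have "open_simplex q' s = (+) b ` A ` open_simplex q s"
    unfolding open_simplex_def
    by (simp only: rel_interior_translation rel_interior_convex_linear_image[OF A convex_convex_hull])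
  then show "(\<lambda>p. A p + b) ` open_simplex q s = open_simplex q' s"
    by (simp add: image_image add.commute)
  show "(\<lambda>p. A p + b) ` closure (open_simplex q s) = closure (open_simplex q' s)"
    unfolding closure_open_simplex hull by (simp add: image_image add.commute)
qed

lemma tangent_space_affine_image:
  assumes A: "linear A" and v: "\<And>k. k \<in> set s \<Longrightarrow> A (q k) + b = q' k" and "hd s \<in> set s"
  shows "A ` tangent_space q s = tangent_space q' s"
proof -
  have "A (q k - q (hd s)) = q' k - q' (hd s)" if "k \<in> set s" for k
    using v[OF that, symmetric] v[OF assms(3), symmetric] by (simp add: linear_diff[OF A])
  then have "A ` (\<lambda>k. q k - q (hd s)) ` set s = (\<lambda>k. q' k - q' (hd s)) ` set s"
    by (auto simp: image_image)
  then show ?thesis unfolding tangent_space_def by (simp add: linear_span_image[OF A, symmetric])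
qed

text \<open>
  Followed by an isometry of its range onto the domain, the map becomes a surjective, hence injective,
  endomorphism.
\<close>

lemma linear_inj_if_dim_range:
  fixes f :: "'a::euclidean_space \<Rightarrow> 'b::euclidean_space"
  assumes f: "linear f" and dim: "dim (range f) = DIM('a)"
  shows "inj f"
proof -
  have sub: "subspace (range f)" using f by (simp add: linear_subspace_image)
  have d: "dim (range f) = dim (UNIV :: 'a set)" using dim by simp
  show ?thesis
  proof (rule isometries_subspaces[OF sub subspace_UNIV d])
    fix g :: "'b \<Rightarrow> 'a" assume g: "linear g" "g ` range f = UNIV"
    then have "surj (g \<circ> f)" by (metis image_comp)
    then have "inj (g \<circ> f)"
      by (rule linear_surjective_imp_injective[OF linear_compose[OF f g(1)]]) simp
    then show "inj f" by (rule inj_on_imageI2)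
  qed
qed

text \<open>
  On one element the pullback coincides with an affine map carrying the current simplex onto the previous
  one. Both simplices are nondegenerate, so the linear part is injective on the tangent space and the area formula
  applies, with the surface Jacobian as its factor.
\<close>

lemma element_change_of_variables:
  fixes q q_old :: "nat \<Rightarrow> real^'n" and f :: "real^'n \<Rightarrow> real"
  assumes k: "CARD('n) = Suc CARD('k::{finite,wellorder})"
    and P: "polyhedral_surface N T q" "polyhedral_surface N T q_old" and s: "s \<in> T"
    and vel: "is_mesh_velocity T q_old q \<tau> vel" and \<tau>: "\<tau> \<noteq> 0"
    and f: "continuous_on (surface T q_old) f"
  defines "\<Phi> \<equiv> pullback_map \<tau> vel"
  shows "(LINT p:open_simplex q_old s|hausdorff CARD('k). f p)
    = (LINT p:open_simplex q s|hausdorff CARD('k). surf_jacobian T q \<Phi> p * f (\<Phi> p))"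
    and "\<exists>c\<ge>0. \<forall>p\<in>open_simplex q s. surf_jacobian T q \<Phi> p = c"
proof -
  note D = polyhedral_surface_elementD[OF P(1) s]
  obtain A b where A: "linear A" and \<Phi>: "\<And>p. p \<in> closure (open_simplex q s) \<Longrightarrow> \<Phi> p = A p + b"
    and v: "\<And>k. k \<in> set s \<Longrightarrow> A (q k) + b = q_old k"
    unfolding \<Phi>_def using pullback_map_affine[OF vel \<tau> s] by metis
  have \<Phi>': "\<Phi> p = A p + b" if "p \<in> open_simplex q s" for p
    using \<Phi> that closure_subset by blast
  obtain Q :: "real^'k::_ \<Rightarrow> real^'n" where Q: "linear Q" "\<And>x. norm (Q x) = norm x"
    "range Q = tangent_space q s"
    and J: "\<And>p. p \<in> open_simplex q s \<Longrightarrow> surf_jacobian T q \<Phi> p = sqrt (gram_det (A \<circ> Q))"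
    using surf_jacobian_affine[OF P(1) s k A \<Phi>', of thesis] by simp
  have AQ: "linear (A \<circ> Q)" using Q A by (intro linear_compose)
  have "range (A \<circ> Q) = tangent_space q_old s"
    using tangent_space_affine_image[OF A v D(2)] by (simp only: image_comp[symmetric] Q(3))
  then have inj: "inj (A \<circ> Q)"
    using dim_tangent_space[OF P(2) s k] by (intro linear_inj_if_dim_range[OF AQ]) simp
  show "\<exists>c\<ge>0. \<forall>p\<in>open_simplex q s. surf_jacobian T q \<Phi> p = c"
    using J gram_det_nonneg[OF AQ inj] by (intro exI[of _ "sqrt (gram_det (A \<circ> Q))"]) auto
  have E: "open_simplex q s \<subseteq> range (\<lambda>y. q (hd s) + Q y)"
    using open_simplex_in_plane[OF D(2), of q] closure_subset[of "open_simplex q s"]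
    unfolding Q(3)[symmetric] by (auto simp: image_image)
  note im = open_simplex_affine_image(1)[OF A v]
  have "set_borel_measurable borel (open_simplex q_old s) f"
    unfolding set_borel_measurable_def
    using f open_simplex_subset_surface[OF s, of q_old]
    by (intro borel_measurable_continuous_on_indicator borel_open_simplex) (rule continuous_on_subset)
  then have "(LINT p:open_simplex q_old s|hausdorff CARD('k). f p)
      = (LINT p:open_simplex q s|hausdorff CARD('k). sqrt (gram_det (A \<circ> Q)) * f (A p + b))"
    using set_integral_affine_map[OF Q(1,2) A inj E bounded_open_simplex borel_open_simplex, of b f]
    by (simp add: im)
  also have "\<dots> = (LINT p:open_simplex q s|hausdorff CARD('k). surf_jacobian T q \<Phi> p * f (\<Phi> p))"
    by (intro set_lebesgue_integral_cong) (auto simp: borel_open_simplex J \<Phi>')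
  finally show "(LINT p:open_simplex q_old s|hausdorff CARD('k). f p)
    = (LINT p:open_simplex q s|hausdorff CARD('k). surf_jacobian T q \<Phi> p * f (\<Phi> p))" .
qed

lemma element_measure:
  fixes q :: "nat \<Rightarrow> real^'n"
  assumes k: "CARD('n) = Suc CARD('k::{finite,wellorder})"
    and P: "polyhedral_surface N T q" and s: "s \<in> T"
  shows "emeasure (hausdorff CARD('k)) (closure (open_simplex q s)) < \<infinity>"
    and "emeasure (hausdorff CARD('k)) (closure (open_simplex q s) - open_simplex q s) = 0"
proof -
  note D = polyhedral_surface_elementD[OF P s]
  have "subspace (tangent_space q s)" by (simp add: tangent_space_def)
  then obtain Q :: "real^'k::_ \<Rightarrow> real^'n" where Q: "linear Q" "\<And>x. norm (Q x) = norm x"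
    "range Q = tangent_space q s"
    using det_on_orthonormal_frame[OF _ dim_tangent_space[OF P s k]] by metis
  have E: "closure (open_simplex q s) \<subseteq> range (\<lambda>y. q (hd s) + Q y)"
    using open_simplex_in_plane[OF D(2), of q]
    unfolding Q(3)[symmetric] by (auto simp: image_image)
  have "inj Q" using Q linear_injective_0[of Q] by (metis norm_eq_zero)
  then show "emeasure (hausdorff CARD('k)) (closure (open_simplex q s)) < \<infinity>"
    using hausdorff_affine_map(2)[OF Q(1,2) linear_id _ E] bounded_open_simplex
    by (auto simp: bounded_closure)
  have "open_simplex q s \<subseteq> range (\<lambda>y. q (hd s) + Q y)"
    using E closure_subset by (rule order_trans[rotated])
  from hausdorff_closure_minus_rel_interior[OF Q(1,2) convex_open_simplex this bounded_open_simplex]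
  show "emeasure (hausdorff CARD('k)) (closure (open_simplex q s) - open_simplex q s) = 0"
    by (simp add: rel_interior_open_simplex)
qed

section \<open>Integrals over polyhedral surfaces\<close>

text \<open>
  The factors \<open>a\<close> and \<open>b\<close> of the energy comparison have this property, which is stable under products and differences and
  implies integrability over the compact surface.
\<close>

definition bounded_borel_on :: "(real^'n) set \<Rightarrow> (real^'n \<Rightarrow> real) \<Rightarrow> bool" where
  "bounded_borel_on S f \<longleftrightarrow> set_borel_measurable borel S f \<and> (\<exists>C. \<forall>p\<in>S. \<bar>f p\<bar> \<le> C)"

lemma bounded_borel_on_mult:
  assumes "bounded_borel_on S f" "bounded_borel_on S g"
  shows "bounded_borel_on S (\<lambda>p. f p * g p)"
proof -
  obtain C D where C: "\<forall>p\<in>S. \<bar>f p\<bar> \<le> C" and D: "\<forall>p\<in>S. \<bar>g p\<bar> \<le> D"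
    using assms unfolding bounded_borel_on_def by blast
  have "(\<lambda>p. (indicator S p *\<^sub>R f p) * (indicator S p *\<^sub>R g p)) \<in> borel_measurable borel"
    using assms unfolding bounded_borel_on_def set_borel_measurable_def
    by (intro borel_measurable_times) auto
  moreover have "(\<lambda>p. (indicator S p *\<^sub>R f p) * (indicator S p *\<^sub>R g p))
      = (\<lambda>p. indicator S p *\<^sub>R (f p * g p))"
    by (auto simp: indicator_def)
  moreover have "\<bar>f p * g p\<bar> \<le> C * D" if "p \<in> S" for p
  proof -
    have "\<bar>f p\<bar> \<le> C" "\<bar>g p\<bar> \<le> D" using C D that by auto
    then show ?thesis unfolding abs_mult by (intro mult_mono) auto
  qed
  ultimately show ?thesis
    unfolding bounded_borel_on_def set_borel_measurable_def by auto
qed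

lemma bounded_borel_on_diff:
  assumes "bounded_borel_on S f" "bounded_borel_on S g"
  shows "bounded_borel_on S (\<lambda>p. f p - g p)"
proof -
  obtain C D where C: "\<forall>p\<in>S. \<bar>f p\<bar> \<le> C" and D: "\<forall>p\<in>S. \<bar>g p\<bar> \<le> D"
    using assms unfolding bounded_borel_on_def by blast
  have "(\<lambda>p. indicator S p *\<^sub>R f p - indicator S p *\<^sub>R g p) \<in> borel_measurable borel"
    using assms unfolding bounded_borel_on_def set_borel_measurable_def
    by (intro borel_measurable_diff) auto
  moreover have "\<bar>f p - g p\<bar> \<le> C + D" if "p \<in> S" for p
  proof -
    have "\<bar>f p\<bar> \<le> C" "\<bar>g p\<bar> \<le> D" using C D that by auto
    then show ?thesis by linarith
  qed
  ultimately show ?thesis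
    unfolding bounded_borel_on_def set_borel_measurable_def by (auto simp: right_diff_distrib)
qed

lemma bounded_borel_on_continuous:
  assumes S: "compact S" and f: "continuous_on S f"
  shows "bounded_borel_on S f"
proof -
  have "bounded (f ` S)" using compact_continuous_image[OF f S] by (rule compact_imp_bounded)
  then have "\<exists>C. \<forall>p\<in>S. \<bar>f p\<bar> \<le> C" by (auto simp: bounded_iff)
  moreover have "S \<in> sets borel" using S by (intro borel_closed compact_imp_closed)
  ultimately show ?thesis
    unfolding bounded_borel_on_def set_borel_measurable_def
    using borel_measurable_continuous_on_indicator[OF _ f] by blast
qed

lemma set_integrable_surface:
  fixes q :: "nat \<Rightarrow> real^'n"
  assumes k: "CARD('n) = Suc CARD('k::{finite,wellorder})" and P: "polyhedral_surface N T q"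
    and f: "bounded_borel_on (surface T q) f"
  shows "set_integrable (hausdorff (CARD('n) - 1)) (surface T q) f"
proof -
  let ?H = "hausdorff CARD('k) :: (real^'n) measure"
  have fin: "finite T" by (rule polyhedral_surfaceD(1)[OF P])
  obtain C where C: "\<forall>p\<in>surface T q. \<bar>f p\<bar> \<le> C" using f unfolding bounded_borel_on_def by blast
  have "emeasure ?H (surface T q) \<le> (\<Sum>s\<in>T. emeasure ?H (closure (open_simplex q s)))"
    unfolding surface_def using fin by (intro emeasure_subadditive_finite) auto
  also have "\<dots> < \<infinity>" using element_measure(1)[OF k P] fin by simp
  finally have fin_surf: "emeasure ?H (surface T q) < \<infinity>" .
  have "integrable ?H (\<lambda>p. indicator (surface T q) p *\<^sub>R f p)"
  proof (rule integrableI_bounded_set[where A = "surface T q" and B = C])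
    show "surface T q \<in> sets ?H" using compact_surface[OF P] by (simp add: borel_closed compact_imp_closed)
    show "(\<lambda>p. indicator (surface T q) p *\<^sub>R f p) \<in> borel_measurable ?H"
      using f unfolding bounded_borel_on_def set_borel_measurable_def
      by (simp add: measurable_cong_sets[OF sets_hausdorff refl])
    show "AE p\<in>surface T q in ?H. norm (indicator (surface T q) p *\<^sub>R f p) \<le> C"
      using C by (intro AE_I2) auto
  qed (use fin_surf in auto)
  then show ?thesis unfolding set_integrable_def k by simp
qed

text \<open>
  The closed elements cover the surface. A common point of two distinct elements lies in the relative
  boundary of at least one of them, and these boundaries are null sets.
\<close>

lemma surface_integral_sum:
  fixes q :: "nat \<Rightarrow> real^'n"
  assumes k: "CARD('n) = Suc CARD('k::{finite,wellorder})" and P: "polyhedral_surface N T q"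
    and f: "bounded_borel_on (surface T q) f"
  shows "surface_integral T q f = (\<Sum>s\<in>T. LINT p:open_simplex q s|hausdorff CARD('k). f p)"
proof -
  let ?H = "hausdorff CARD('k) :: (real^'n) measure"
  let ?cl = "\<lambda>s. closure (open_simplex q s)"
  have int: "set_integrable ?H (surface T q) f"
    using set_integrable_surface[OF k P f] by (simp add: k)
  have sub: "?cl s \<subseteq> surface T q" if "s \<in> T" for s using that by (auto simp: surface_def)
  have ae: "AE p in ?H. p \<in> ?cl s \<longleftrightarrow> p \<in> open_simplex q s" if s: "s \<in> T" for s
  proof (rule AE_I)
    show "{p \<in> space ?H. \<not> (p \<in> ?cl s \<longleftrightarrow> p \<in> open_simplex q s)} \<subseteq> ?cl s - open_simplex q s"
      using closure_subset[of "open_simplex q s"] by auto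
    show "emeasure ?H (?cl s - open_simplex q s) = 0" by (rule element_measure(2)[OF k P s])
    show "?cl s - open_simplex q s \<in> sets ?H"
      by (intro sets.Diff) (simp_all add: borel_open_simplex)
  qed
  have "surface_integral T q f = (LINT p:(\<Union>s\<in>T. ?cl s)|?H. f p)"
    by (simp add: surface_integral_def surface_def k)
  also have "\<dots> = (\<Sum>s\<in>T. LINT p:?cl s|?H. f p)"
  proof (rule set_integral_finite_UN_AE)
    show "finite T" by (rule polyhedral_surfaceD(1)[OF P])
    show "AE p in ?H. p \<in> ?cl s \<and> p \<in> ?cl t \<longrightarrow> s = t" if "s \<in> T" "t \<in> T" for s t
      using ae[OF that(1)] ae[OF that(2)]
      by eventually_elim (use polyhedral_surfaceD(2)[OF P that] in blast)
    show "set_integrable ?H (?cl s) f" if "s \<in> T" for s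
      by (rule set_integrable_subset[OF int _ sub[OF that]]) auto
  qed auto
  also have "\<dots> = (\<Sum>s\<in>T. LINT p:open_simplex q s|?H. f p)"
  proof (rule sum.cong[OF refl])
    fix s assume s: "s \<in> T"
    have i: "set_integrable ?H (?cl s) f" "set_integrable ?H (open_simplex q s) f"
      using set_integrable_subset[OF int _ sub[OF s]]
        set_integrable_subset[OF int _ open_simplex_subset_surface[OF s]] borel_open_simplex[of q s]
      by simp_all
    show "(LINT p:?cl s|?H. f p) = (LINT p:open_simplex q s|?H. f p)"
      using ae[OF s] i by (intro set_integral_cong_set)
        (auto simp: set_integrable_def set_borel_measurable_def dest: borel_measurable_integrable)
  qed
  finally show ?thesis .
qed

lemma pullback_map_surface:
  assumes vel: "is_mesh_velocity T q_old q \<tau> vel" and \<tau>: "\<tau> \<noteq> 0"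
  shows "continuous_on (surface T q) (pullback_map \<tau> vel)"
    and "pullback_map \<tau> vel ` surface T q \<subseteq> surface T q_old"
proof -
  have "continuous_on (surface T q) vel" using vel by (simp add: is_mesh_velocity_def Vh_def)
  then show "continuous_on (surface T q) (pullback_map \<tau> vel)"
    unfolding pullback_map_def by (intro continuous_intros)
  show "pullback_map \<tau> vel ` surface T q \<subseteq> surface T q_old"
  proof (rule image_subsetI)
    fix p assume "p \<in> surface T q"
    then obtain s where s: "s \<in> T" "p \<in> closure (open_simplex q s)" by (auto simp: surface_def)
    obtain A b where A: "linear A" "\<And>p. p \<in> closure (open_simplex q s) \<Longrightarrow> pullback_map \<tau> vel p = A p + b"
      "\<And>k. k \<in> set s \<Longrightarrow> A (q k) + b = q_old k"
      using pullback_map_affine[OF vel \<tau> s(1)] by metis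
    have "pullback_map \<tau> vel p \<in> closure (open_simplex q_old s)"
      using open_simplex_affine_image(2)[OF A(1,3)] A(2) s(2) by force
    then show "pullback_map \<tau> vel p \<in> surface T q_old" using s(1) by (auto simp: surface_def)
  qed
qed

text \<open>
  The Jacobian is constant on each open element and zero elsewhere, that is, a finite
  combination of indicator functions.
\<close>

lemma surf_jacobian_bounded_borel:
  fixes q q_old :: "nat \<Rightarrow> real^'n"
  assumes k: "CARD('n) = Suc CARD('k::{finite,wellorder})"
    and P: "polyhedral_surface N T q" "polyhedral_surface N T q_old"
    and vel: "is_mesh_velocity T q_old q \<tau> vel" and \<tau>: "\<tau> \<noteq> 0"
  defines "J \<equiv> surf_jacobian T q (pullback_map \<tau> vel)"
  shows "bounded_borel_on (surface T q) (\<lambda>p. sqrt (J p))" and "J p \<ge> 0"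
proof -
  have fin: "finite T" by (rule polyhedral_surfaceD(1)[OF P(1)])
  have "\<forall>s\<in>T. \<exists>c. c \<ge> 0 \<and> (\<forall>p\<in>open_simplex q s. J p = c)"
    using element_change_of_variables(2)[OF k P _ vel \<tau>, of _ "\<lambda>_. 0"] unfolding J_def by auto
  then obtain c where c: "\<And>s. s \<in> T \<Longrightarrow> c s \<ge> 0" "\<And>s p. s \<in> T \<Longrightarrow> p \<in> open_simplex q s \<Longrightarrow> J p = c s"
    by metis
  have J: "J p = (\<Sum>s\<in>T. c s * indicator (open_simplex q s) p)" for p
  proof (cases "\<exists>s\<in>T. p \<in> open_simplex q s")
    case True
    then obtain s where s: "s \<in> T" "p \<in> open_simplex q s" by blast
    have "(\<Sum>t\<in>T. c t * indicator (open_simplex q t) p) = (\<Sum>t\<in>T. if t = s then c s else 0)"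
      using s polyhedral_surfaceD(2)[OF P(1)] by (intro sum.cong) (auto simp: indicator_def)
    then show ?thesis using s fin c(2) by simp
  next
    case False
    then show ?thesis by (simp add: J_def surf_jacobian_def elementwise_def indicator_def)
  qed
  show "J p \<ge> 0" for p unfolding J using c(1) by (intro sum_nonneg) auto
  have "J \<in> borel_measurable borel"
    unfolding J[abs_def]
    by (intro borel_measurable_sum borel_measurable_times borel_measurable_const
        borel_measurable_indicator borel_open_simplex)
  moreover have "\<bar>sqrt (J p)\<bar> \<le> sqrt (\<Sum>s\<in>T. c s)" for p
  proof -
    have "J p \<le> (\<Sum>s\<in>T. c s)" unfolding J using c(1)
      by (intro sum_mono) (auto simp: indicator_def)
    then show ?thesis using \<open>\<And>p. J p \<ge> 0\<close> by simp
  qed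
  moreover have "surface T q \<in> sets borel"
    using compact_surface[OF P(1)] by (intro borel_closed compact_imp_closed)
  ultimately show "bounded_borel_on (surface T q) (\<lambda>p. sqrt (J p))"
    unfolding bounded_borel_on_def set_borel_measurable_def by auto
qed

lemma surface_change_of_variables:
  fixes q q_old :: "nat \<Rightarrow> real^'n"
  assumes k: "CARD('n) = Suc CARD('k::{finite,wellorder})"
    and P: "polyhedral_surface N T q" "polyhedral_surface N T q_old"
    and vel: "is_mesh_velocity T q_old q \<tau> vel" and \<tau>: "\<tau> \<noteq> 0"
    and f: "continuous_on (surface T q_old) f"
  defines "\<Phi> \<equiv> pullback_map \<tau> vel"
  shows "surface_integral T q_old f = surface_integral T q (\<lambda>p. surf_jacobian T q \<Phi> p * f (\<Phi> p))"
proof -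
  have "bounded_borel_on (surface T q) (\<lambda>p. f (\<Phi> p))"
    using pullback_map_surface[OF vel \<tau>] f unfolding \<Phi>_def
    by (intro bounded_borel_on_continuous compact_surface[OF P(1)] continuous_on_compose2[OF f]) auto
  moreover note jac = surf_jacobian_bounded_borel[OF k P vel \<tau>, folded \<Phi>_def]
  have "bounded_borel_on (surface T q) (\<lambda>p. surf_jacobian T q \<Phi> p)"
    using bounded_borel_on_mult[OF jac(1) jac(1)] jac(2) by simp
  ultimately have "bounded_borel_on (surface T q) (\<lambda>p. surf_jacobian T q \<Phi> p * f (\<Phi> p))"
    by (intro bounded_borel_on_mult)
  then show ?thesis
    using element_change_of_variables(1)[OF k P _ vel \<tau> f]
    by (simp add: surface_integral_sum[OF k P(1)] \<Phi>_def
        surface_integral_sum[OF k P(2) bounded_borel_on_continuous[OF compact_surface[OF P(2)] f]])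
qed

section \<open>The energy estimate\<close>

text \<open>
  Test the velocity equation with \<open>V\<close> and the curvature equation with \<open>\<kappa>new - \<kappa>bar\<close>. In the sum the gradient terms
  cancel because a constant does not change the surface gradient, the terms with the weight \<open>Wsq\<close> and those with the
  evolution curvature cancel by symmetry, the antisymmetric form vanishes on equal arguments, and the
  two constraints remove the Lagrange multipliers.
\<close>

lemma linear_system_energy_identity:
  fixes q :: "nat \<Rightarrow> real^'n"
  assumes V: "V \<in> Vh T q" and \<kappa>new: "\<kappa>new \<in> Vh T q" and \<tau>: "\<tau> \<noteq> 0"
    and sys: "linear_system T q \<tau> \<kappa>bar \<kappa>e \<kappa>g v vel V \<kappa>new lam mu"
  defines "\<Phi> \<equiv> pullback_map \<tau> vel"
  shows "surface_integral T q (\<lambda>p. (\<kappa>new p - \<kappa>bar - (\<kappa>e (\<Phi> p) - \<kappa>bar) * sqrt (surf_jacobian T q \<Phi> p))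
      * (\<kappa>new p - \<kappa>bar)) = - \<tau> * L2_inner T q V V"
proof -
  define a where "a p = \<kappa>new p - \<kappa>bar" for p
  define J where "J = surf_jacobian T q \<Phi>"
  define W where "W = Wsq T q v"
  define \<kappa>\<Gamma> where "\<kappa>\<Gamma> p = \<kappa>e (\<Phi> p)" for p
  note sys' = sys[unfolded linear_system_def Let_def, folded \<Phi>_def J_def W_def]
  have aV: "a \<in> Vh T q"
  proof -
    have "\<forall>s\<in>T. \<exists>A b. linear A \<and> (\<forall>p\<in>open_simplex q s. \<kappa>new p = A p + b)"
      using \<kappa>new by (simp add: Vh_def)
    moreover have "(\<forall>p\<in>X. \<kappa>new p = A p + b) \<Longrightarrow> (\<forall>p\<in>X. a p = A p + (b - \<kappa>bar))" for X A b
      by (simp add: a_def)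
    ultimately have "\<forall>s\<in>T. \<exists>A b. linear A \<and> (\<forall>p\<in>open_simplex q s. a p = A p + b)"
      by meson
    moreover have "continuous_on (surface T q) a"
      using \<kappa>new unfolding Vh_def a_def by (intro continuous_on_diff continuous_on_const) blast
    ultimately show ?thesis by (simp add: Vh_def)
  qed
  have grad_a: "surf_grad T q a = surf_grad T q \<kappa>new"
  proof -
    have "(a has_derivative D) F \<longleftrightarrow> (\<kappa>new has_derivative D) F" for D F
    proof
      assume "(a has_derivative D) F"
      from has_derivative_add[OF this has_derivative_const[of \<kappa>bar]]
      show "(\<kappa>new has_derivative D) F" by (simp add: a_def)
    next
      assume "(\<kappa>new has_derivative D) F"
      from has_derivative_diff[OF this has_derivative_const[of \<kappa>bar]]
      show "(a has_derivative D) F" by (simp add: a_def[abs_def])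
    qed
    then show ?thesis by (simp add: surf_grad_def)
  qed
  have comm: "L2_inner T q f g = L2_inner T q g f" for f g :: "real^'n \<Rightarrow> 'c::real_inner"
    by (simp add: L2_inner_def inner_commute)
  have cong: "L2_inner T q f g = L2_inner T q f' g'" if "\<And>p. f p * g p = f' p * g' p"
    for f g f' g' :: "real^'n \<Rightarrow> real"
    by (simp add: L2_inner_def that)
  have vol: "L2_inner T q (\<lambda>p. 1) V = 0" and area: "L2_inner T q (\<kappa>g \<circ> \<Phi>) V = 0"
    using sys' cong[of "\<kappa>g \<circ> \<Phi>" V "\<lambda>p. V p * (\<kappa>g \<circ> \<Phi>) p" "\<lambda>p. 1"] comm[of "\<lambda>p. 1" V]
    by (simp_all add: mult.commute)
  have "L2_inner T q V V - L2_inner T q (surf_grad T q \<kappa>new) (surf_grad T q V)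
      + L2_inner T q (\<lambda>p. W p * a p) V
      - 1/2 * L2_inner T q (\<lambda>p. (\<kappa>\<Gamma> p - \<kappa>bar) * \<kappa>\<Gamma> p * a p) V
      - lam * L2_inner T q (\<lambda>p. 1) V - mu * L2_inner T q (\<kappa>g \<circ> \<Phi>) V = 0"
    using sys' V by (simp add: a_def \<kappa>\<Gamma>_def)
  moreover have "L2_inner T q (\<lambda>p. (a p - (\<kappa>\<Gamma> p - \<kappa>bar) * sqrt (J p)) / \<tau>) a
      - antisym_form T q vel a a + L2_inner T q (surf_grad T q V) (surf_grad T q a)
      - L2_inner T q (\<lambda>p. W p * V p) a
      + 1/2 * L2_inner T q V (\<lambda>p. (\<kappa>\<Gamma> p - \<kappa>bar) * \<kappa>\<Gamma> p * a p) = 0"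
    using sys' aV by (simp add: a_def[abs_def] \<kappa>\<Gamma>_def J_def)
  moreover have "L2_inner T q (\<lambda>p. W p * V p) a = L2_inner T q (\<lambda>p. W p * a p) V"
    by (rule cong) simp
  ultimately have "L2_inner T q (\<lambda>p. (a p - (\<kappa>\<Gamma> p - \<kappa>bar) * sqrt (J p)) / \<tau>) a = - L2_inner T q V V"
    using vol area comm[of "surf_grad T q V" "surf_grad T q \<kappa>new"]
      comm[of V "\<lambda>p. (\<kappa>\<Gamma> p - \<kappa>bar) * \<kappa>\<Gamma> p * a p"]
    by (simp add: grad_a antisym_form_def)
  moreover have "L2_inner T q (\<lambda>p. (a p - (\<kappa>\<Gamma> p - \<kappa>bar) * sqrt (J p)) / \<tau>) a
      = (1 / \<tau>) * surface_integral T q (\<lambda>p. (a p - (\<kappa>\<Gamma> p - \<kappa>bar) * sqrt (J p)) * a p)"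
    unfolding L2_inner_def surface_integral_def set_integral_mult_right[symmetric]
    by (simp add: divide_simps)
  ultimately have "surface_integral T q (\<lambda>p. (a p - (\<kappa>\<Gamma> p - \<kappa>bar) * sqrt (J p)) * a p)
      = - \<tau> * L2_inner T q V V"
    using \<tau> by (simp add: field_simps)
  then show ?thesis by (simp add: a_def \<kappa>\<Gamma>_def J_def)
qed

text \<open>
  With \<open>a = \<kappa>new - \<kappa>bar\<close> and \<open>b = (\<kappa>e \<circ> \<Phi> - \<kappa>bar) * sqrt J\<close> the energy identity reads
  \<open>\<integral> (a - b) * a = - \<tau> * \<parallel>V\<parallel>\<^sup>2\<close>. The integrand is at least \<open>a\<^sup>2 / 2 - b\<^sup>2 / 2\<close>, the two halves of which integrate
  to the new and to the old energy; for the latter, \<open>b\<^sup>2\<close> is the old integrand times the Jacobian of \<open>\<Phi>\<close>.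
  The type \<open>'k\<close> provides the coordinates on the elements and has one index less than the ambient space.
\<close>

lemma energy_stability:
  fixes q q_old :: "nat \<Rightarrow> real^'n"
  assumes k: "CARD('n) = Suc CARD('k::{finite,wellorder})" and \<tau>: "\<tau> > 0"
    and P: "polyhedral_surface N T q" "polyhedral_surface N T q_old"
    and \<kappa>e: "\<kappa>e \<in> Vh T q_old" and vel: "is_mesh_velocity T q_old q \<tau> vel"
    and V: "V \<in> Vh T q" and \<kappa>new: "\<kappa>new \<in> Vh T q"
    and sys: "linear_system T q \<tau> \<kappa>bar \<kappa>e \<kappa>g v vel V \<kappa>new lam mu"
  shows "energy T q \<kappa>bar \<kappa>new + \<tau> * (L2_norm T q V)\<^sup>2 \<le> energy T q_old \<kappa>bar \<kappa>e"
proof -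
  have \<tau>0: "\<tau> \<noteq> 0" using \<tau> by simp
  define \<Phi> where "\<Phi> = pullback_map \<tau> vel"
  define J where "J = surf_jacobian T q \<Phi>"
  define a where "a p = \<kappa>new p - \<kappa>bar" for p
  define b where "b p = (\<kappa>e (\<Phi> p) - \<kappa>bar) * sqrt (J p)" for p
  let ?H = "hausdorff (CARD('n) - 1) :: (real^'n) measure" and ?S = "surface T q"
  have cont_e: "continuous_on (surface T q_old) \<kappa>e" using \<kappa>e by (simp add: Vh_def)
  have "continuous_on ?S a"
    using \<kappa>new unfolding Vh_def a_def by (intro continuous_on_diff continuous_on_const) blast
  then have a: "bounded_borel_on ?S a"
    by (rule bounded_borel_on_continuous[OF compact_surface[OF P(1)]])
  have "continuous_on ?S (\<lambda>p. \<kappa>e (\<Phi> p) - \<kappa>bar)"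
    using pullback_map_surface[OF vel \<tau>0] unfolding \<Phi>_def
    by (intro continuous_on_diff continuous_on_const continuous_on_compose2[OF cont_e]) auto
  then have b: "bounded_borel_on ?S b"
    unfolding b_def[abs_def] J_def \<Phi>_def
    by (intro bounded_borel_on_mult surf_jacobian_bounded_borel(1)[OF k P vel \<tau>0]
        bounded_borel_on_continuous[OF compact_surface[OF P(1)]])
  note int = set_integrable_surface[OF k P(1)]
  have ia: "set_integrable ?H ?S (\<lambda>p. 1/2 * (a p)\<^sup>2)" and ib: "set_integrable ?H ?S (\<lambda>p. 1/2 * (b p)\<^sup>2)"
    unfolding power2_eq_square by (intro set_integrable_mult_right int bounded_borel_on_mult a b)+
  have "1/2 * surface_integral T q (\<lambda>p. (a p)\<^sup>2) - 1/2 * surface_integral T q (\<lambda>p. (b p)\<^sup>2)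
      = (LINT p:?S|?H. 1/2 * (a p)\<^sup>2 - 1/2 * (b p)\<^sup>2)"
    using set_integral_diff(2)[OF ia ib] by (simp add: surface_integral_def)
  also have "\<dots> \<le> (LINT p:?S|?H. (a p - b p) * a p)"
  proof (rule set_integral_mono)
    show "set_integrable ?H ?S (\<lambda>p. 1/2 * (a p)\<^sup>2 - 1/2 * (b p)\<^sup>2)"
      using set_integral_diff(1)[OF ia ib] .
    show "set_integrable ?H ?S (\<lambda>p. (a p - b p) * a p)"
      by (intro int bounded_borel_on_mult bounded_borel_on_diff a b)
    fix p
    \<comment> \<open>The difference of the two sides is \<open>(a p - b p)\<^sup>2 / 2\<close>.\<close>
    show "1/2 * (a p)\<^sup>2 - 1/2 * (b p)\<^sup>2 \<le> (a p - b p) * a p"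
      using zero_le_power2[of "a p - b p"] by (simp add: power2_eq_square algebra_simps)
  qed
  also have "\<dots> = - \<tau> * L2_inner T q V V"
    using linear_system_energy_identity[OF V \<kappa>new \<tau>0 sys]
    by (simp add: surface_integral_def a_def b_def J_def \<Phi>_def)
  finally have "1/2 * surface_integral T q (\<lambda>p. (a p)\<^sup>2) + \<tau> * L2_inner T q V V
      \<le> 1/2 * surface_integral T q (\<lambda>p. (b p)\<^sup>2)" by simp
  moreover have "surface_integral T q (\<lambda>p. (b p)\<^sup>2) = surface_integral T q_old (\<lambda>p. (\<kappa>e p - \<kappa>bar)\<^sup>2)"
  proof -
    have "continuous_on (surface T q_old) (\<lambda>p. (\<kappa>e p - \<kappa>bar)\<^sup>2)"
      using cont_e by (intro continuous_intros)
    moreover have "(b p)\<^sup>2 = J p * (\<kappa>e (\<Phi> p) - \<kappa>bar)\<^sup>2" for p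
      using surf_jacobian_bounded_borel(2)[OF k P vel \<tau>0, of p]
      by (simp add: b_def power_mult_distrib J_def \<Phi>_def)
    ultimately show ?thesis
      using surface_change_of_variables[OF k P vel \<tau>0] by (simp add: J_def \<Phi>_def)
  qed
  moreover have "(L2_norm T q V)\<^sup>2 = L2_inner T q V V"
  proof -
    have "L2_inner T q V V \<ge> 0"
      unfolding L2_inner_def surface_integral_def set_lebesgue_integral_def
      by (intro Bochner_Integration.integral_nonneg) simp
    then show ?thesis by (simp add: L2_norm_def)
  qed
  ultimately show ?thesis by (simp add: energy_def a_def)
qed

theorem theorem3p4:
  fixes \<tau> \<kappa>bar :: real and m :: nat
  assumes "\<tau> > 0"
  shows
   "(\<forall>T (q :: nat \<Rightarrow> nat \<Rightarrow> real^2) \<kappa>e \<kappa>g \<omega> v vel V \<kappa>new lam mu.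
       polyhedral_surface normal2 T (q (m - 1)) \<longrightarrow>
       polyhedral_surface normal2 T (q m) \<longrightarrow>
       \<kappa>e \<in> Vh T (q (m - 1)) \<longrightarrow>
       \<kappa>g \<in> Vh T (q (m - 1)) \<longrightarrow>
       is_averaged_normal normal2 T (q m) \<omega> \<longrightarrow>
       (\<forall>k\<in>vertices T. \<omega> (q m k) \<noteq> 0) \<longrightarrow>
       is_vertex_normal T (q m) \<omega> v \<longrightarrow>
       is_mesh_velocity T (q (m - 1)) (q m) \<tau> vel \<longrightarrow>
       V \<in> Vh T (q m) \<longrightarrow>
       \<kappa>new \<in> Vh T (q m) \<longrightarrow>
       linear_system T (q m) \<tau> \<kappa>bar \<kappa>e \<kappa>g v vel V \<kappa>new lam mu \<longrightarrow>
       energy T (q m) \<kappa>bar \<kappa>new + \<tau> * (L2_norm T (q m) V)\<^sup>2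
         \<le> energy T (q (m - 1)) \<kappa>bar \<kappa>e)
    \<and>
    (\<forall>T (q :: nat \<Rightarrow> nat \<Rightarrow> real^3) \<kappa>e \<kappa>g \<omega> v vel V \<kappa>new lam mu.
       polyhedral_surface normal3 T (q (m - 1)) \<longrightarrow>
       polyhedral_surface normal3 T (q m) \<longrightarrow>
       \<kappa>e \<in> Vh T (q (m - 1)) \<longrightarrow>
       \<kappa>g \<in> Vh T (q (m - 1)) \<longrightarrow>
       is_averaged_normal normal3 T (q m) \<omega> \<longrightarrow>
       (\<forall>k\<in>vertices T. \<omega> (q m k) \<noteq> 0) \<longrightarrow>
       is_vertex_normal T (q m) \<omega> v \<longrightarrow>
       is_mesh_velocity T (q (m - 1)) (q m) \<tau> vel \<longrightarrow>
       V \<in> Vh T (q m) \<longrightarrow>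
       \<kappa>new \<in> Vh T (q m) \<longrightarrow>
       linear_system T (q m) \<tau> \<kappa>bar \<kappa>e \<kappa>g v vel V \<kappa>new lam mu \<longrightarrow>
       energy T (q m) \<kappa>bar \<kappa>new + \<tau> * (L2_norm T (q m) V)\<^sup>2
         \<le> energy T (q (m - 1)) \<kappa>bar \<kappa>e)"
proof (intro conjI allI impI)
  have "CARD(2) = Suc CARD(1)" by simp
  from energy_stability[OF this assms, of normal2] show
    "energy T (q m) \<kappa>bar \<kappa>new + \<tau> * (L2_norm T (q m) V)\<^sup>2 \<le> energy T (q (m - 1)) \<kappa>bar \<kappa>e"
    if "polyhedral_surface normal2 T (q (m - 1))" "polyhedral_surface normal2 T (q m)"
      "\<kappa>e \<in> Vh T (q (m - 1))" "is_mesh_velocity T (q (m - 1)) (q m) \<tau> vel"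
      "V \<in> Vh T (q m)" "\<kappa>new \<in> Vh T (q m)"
      "linear_system T (q m) \<tau> \<kappa>bar \<kappa>e \<kappa>g v vel V \<kappa>new lam mu"
    for T and q :: "nat \<Rightarrow> nat \<Rightarrow> real^2" and \<kappa>e \<kappa>g v vel V \<kappa>new lam mu
    using that by blast
next
  have "CARD(3) = Suc CARD(2)" by simp
  from energy_stability[OF this assms, of normal3] show
    "energy T (q m) \<kappa>bar \<kappa>new + \<tau> * (L2_norm T (q m) V)\<^sup>2 \<le> energy T (q (m - 1)) \<kappa>bar \<kappa>e"
    if "polyhedral_surface normal3 T (q (m - 1))" "polyhedral_surface normal3 T (q m)"
      "\<kappa>e \<in> Vh T (q (m - 1))" "is_mesh_velocity T (q (m - 1)) (q m) \<tau> vel"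
      "V \<in> Vh T (q m)" "\<kappa>new \<in> Vh T (q m)"
      "linear_system T (q m) \<tau> \<kappa>bar \<kappa>e \<kappa>g v vel V \<kappa>new lam mu"
    for T and q :: "nat \<Rightarrow> nat \<Rightarrow> real^3" and \<kappa>e \<kappa>g v vel V \<kappa>new lam mu
    using that by blast
qed

end
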